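(* Let $s, m \ge 1$ and $n_1, \dotsc, n_s \ge 1$ be integers. For $j = 1, \dotsc, s$, let $p_j \in \beta\mathbb{Z}^{n_j}$ be an idempotent ultrafilter, and let $U_1, \dotsc, U_m$ be commuting unitary operators on a Hilbert space $\mathcal{H}$. Let $f_1, \dotsc, f_m \in \mathrm{Int}[\vec{z}_1, \dotsc, \vec{z}_s]$ be polynomials, where the variable $\vec{z}_j$ has dimension $n_j$, satisfying $f_i(0) = 0$ for all $i = 1, \dotsc, m$. Define an operator $P$ on $\mathcal{H}$ by the (iterated) weak operator limit $$P = p_1\text{-}\lim_{\vec{z}_1} \cdots\, p_s\text{-}\lim_{\vec{z}_s}\ \prod_{i=1}^{m} U_i^{f_i(\vec{z}_1, \dotsc, \vec{z}_s)}.$$ Then $P$ is an orthogonal projection. Moreover, any two operators defined in this way (from the same $U_1, \dotsc, U_m$, but possibly different choices of $s$, $n_j$, $p_j$ and $f_i$) commute.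
   Context: An ultrafilter $p$ on a commutative semigroup $(S,\circ)$ is a collection of subsets of $S$ such that $S \in p$, $\emptyset \notin p$; $p$ is closed under supersets and finite intersections; and for every $A \subseteq S$ either $A \in p$ or $S \setminus A \in p$. The set of all ultrafilters on $S$ (principal ones included) is $\beta S$. For $p, q \in \beta S$ the product $p \circ q \in \beta S$ is defined by: $A \in p \circ q$ if and only if $\{s \in S : \{t \in S : s \circ t \in A\} \in q\} \in p$. An ultrafilter $p$ is idempotent if $p \circ p = p$. For $S = \mathbb{Z}^n$ the semigroup operation is addition. For a map $f : S \to Y$ into a topological space, $y = p\text{-}\lim_s f(s)$ means that $f^{-1}(U) \in p$ for every neighborhood $U$ of $y$; when $Y$ is compact (Hausdorff) such limits exist and are unique. For a uniformly bounded family of operators $T_s$ on $\mathcal{H}$, the weak operator limit $T = p\text{-}\lim_s T_s$ is the operator with $\langle T x, y\rangle = p\text{-}\lim_s \langle T_s x, y\rangle$ for all $x, y \in \mathcal{H}$; iterated limits are taken successively from the innermost (rightmost) outwards, so that here $\langle Px,y\rangle = p_1\text{-}\lim_{\vec z_1}\cdots p_s\text{-}\lim_{\vec z_s}\langle \prod_i U_i^{f_i(\vec z_1,\dotsc,\vec z_s)}x,y\rangle$, with $\vec z_j$ ranging over $\mathbb{Z}^{n_j}$. $\mathrm{Int}[\vec{z}_1, \dotsc, \vec{z}_s]$ denotes the additive group of polynomials with rational coefficients in all the coordinates of $\vec{z}_1, \dotsc, \vec{z}_s$ that take integer values at all integer arguments. *)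

theory Defs
  imports "HOL-Analysis.Analysis" "HOL-Library.Poly_Mapping"
begin

section \<open>Complex Hilbert spaces and operators\<close>

text \<open>The norm, and hence completeness (class \<open>banach\<close>), is the one induced by the inner product,
  which is linear in its first argument.\<close>

class complex_hilbert_space = banach +
  fixes scaleC :: "complex \<Rightarrow> 'a \<Rightarrow> 'a"  (infixr "*\<^sub>C" 75)
    and cinner :: "'a \<Rightarrow> 'a \<Rightarrow> complex"
  assumes scaleC_add_right: "c *\<^sub>C (x + y) = c *\<^sub>C x + c *\<^sub>C y"
    and scaleC_add_left: "(c + d) *\<^sub>C x = c *\<^sub>C x + d *\<^sub>C x"
    and scaleC_scaleC: "c *\<^sub>C d *\<^sub>C x = (c * d) *\<^sub>C x"
    and scaleC_of_real: "complex_of_real r *\<^sub>C x = r *\<^sub>R x"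
    and cinner_add_left: "cinner (x + y) z = cinner x z + cinner y z"
    and cinner_scaleC_left: "cinner (c *\<^sub>C x) y = c * cinner x y"
    and cinner_commute: "cinner y x = cnj (cinner x y)"
    and cinner_self: "cinner x x = complex_of_real ((norm x)\<^sup>2)"

instantiation complex :: complex_hilbert_space
begin

definition scaleC_complex :: "complex \<Rightarrow> complex \<Rightarrow> complex"
  where "scaleC_complex c x = c * x"

definition cinner_complex :: "complex \<Rightarrow> complex \<Rightarrow> complex"
  where "cinner_complex x y = x * cnj y"

instance
proof
  fix c d x y z :: complex and r :: real
  show "c *\<^sub>C (x + y) = c *\<^sub>C x + c *\<^sub>C y"
    and "(c + d) *\<^sub>C x = c *\<^sub>C x + d *\<^sub>C x"
    and "c *\<^sub>C d *\<^sub>C x = (c * d) *\<^sub>C x"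
    by (simp_all add: scaleC_complex_def distrib_left distrib_right mult.assoc)
  show "complex_of_real r *\<^sub>C x = r *\<^sub>R x"
    by (simp add: scaleC_complex_def scaleR_conv_of_real)
  show "cinner (x + y) z = cinner x z + cinner y z"
    by (simp add: cinner_complex_def distrib_right)
  show "cinner (c *\<^sub>C x) y = c * cinner x y"
    by (simp add: cinner_complex_def scaleC_complex_def mult.assoc)
  show "cinner y x = cnj (cinner x y)"
    by (simp add: cinner_complex_def mult.commute)
  show "cinner x x = complex_of_real ((norm x)\<^sup>2)"
    unfolding cinner_complex_def by (rule complex_norm_square [symmetric])
qed

end

definition bounded_clinear :: "('a::complex_hilbert_space \<Rightarrow> 'a) \<Rightarrow> bool"
  where "bounded_clinear T \<longleftrightarrow> bounded_linear T \<and> (\<forall>c x. T (c *\<^sub>C x) = c *\<^sub>C T x)"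

definition unitary :: "('a::complex_hilbert_space \<Rightarrow> 'a) \<Rightarrow> bool"
  where "unitary U \<longleftrightarrow>
    bounded_clinear U \<and> surj U \<and> (\<forall>x y. cinner (U x) (U y) = cinner x y)"

definition closed_csubspace :: "'a::complex_hilbert_space set \<Rightarrow> bool"
  where "closed_csubspace M \<longleftrightarrow>
    closed M \<and> 0 \<in> M \<and> (\<forall>x\<in>M. \<forall>y\<in>M. x + y \<in> M) \<and> (\<forall>c. \<forall>x\<in>M. c *\<^sub>C x \<in> M)"

definition orthogonal_projection :: "('a::complex_hilbert_space \<Rightarrow> 'a) \<Rightarrow> bool"
  where "orthogonal_projection P \<longleftrightarrow>
    (\<exists>M. closed_csubspace M \<and> (\<forall>x. P x \<in> M \<and> (\<forall>y\<in>M. cinner (x - P x) y = 0)))"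

definition int_power :: "('a \<Rightarrow> 'a) \<Rightarrow> int \<Rightarrow> 'a \<Rightarrow> 'a"
  where "int_power U k = (if k \<ge> 0 then U ^^ nat k else inv U ^^ nat (- k))"


section \<open>Ultrafilters\<close>

definition ultrafilter :: "'a filter \<Rightarrow> bool"
  where "ultrafilter p \<longleftrightarrow>
    p \<noteq> bot \<and> (\<forall>A. eventually (\<lambda>s. s \<in> A) p \<or> eventually (\<lambda>s. s \<notin> A) p)"

definition filter_plus :: "'a::plus filter \<Rightarrow> 'a filter \<Rightarrow> 'a filter"
  where "filter_plus p q = Abs_filter (\<lambda>A. \<forall>\<^sub>F s in p. \<forall>\<^sub>F t in q. A (s + t))"

lemma eventually_filter_plus:
  "eventually A (filter_plus p q) \<longleftrightarrow> (\<forall>\<^sub>F s in p. \<forall>\<^sub>F t in q. A (s + t))"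
  unfolding filter_plus_def
proof (rule eventually_Abs_filter, rule is_filter.intro)
  fix P Q :: "'a \<Rightarrow> bool"
  assume "\<forall>x. P x \<longrightarrow> Q x" and "\<forall>\<^sub>F s in p. \<forall>\<^sub>F t in q. P (s + t)"
  then show "\<forall>\<^sub>F s in p. \<forall>\<^sub>F t in q. Q (s + t)"
    by (blast intro: eventually_mono)
qed (simp_all add: eventually_conj_iff)

text \<open>The group \<open>\<int>\<^sup>n\<close> is the set of finitely supported integer sequences supported in \<open>{..<n}\<close>.  An
  ultrafilter on \<open>\<int>\<^sup>n\<close> is an ultrafilter on all such sequences that contains this subgroup.\<close>

definition int_vecs :: "nat \<Rightarrow> (nat \<Rightarrow>\<^sub>0 int) set"
  where "int_vecs n = {v. Poly_Mapping.keys v \<subseteq> {..<n}}"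

definition idempotent_ultrafilter :: "nat \<Rightarrow> (nat \<Rightarrow>\<^sub>0 int) filter \<Rightarrow> bool"
  where "idempotent_ultrafilter n p \<longleftrightarrow>
    ultrafilter p \<and> (\<forall>\<^sub>F v in p. v \<in> int_vecs n) \<and> filter_plus p p = p"

text \<open>\<open>has_iterated_limit [p\<^sub>1, \<dots>, p\<^sub>s] F l\<close> says that all the limits in
  \<open>p\<^sub>1-lim\<^sub>z\<^sub>1 \<dots> p\<^sub>s-lim\<^sub>z\<^sub>s F [z\<^sub>1, \<dots>, z\<^sub>s]\<close> exist and that the value is \<open>l\<close>; \<open>g z\<close> is the value
  of the inner limits with the outermost variable fixed to \<open>z\<close>.\<close>

primrec has_iterated_limit ::
    "'z filter list \<Rightarrow> ('z list \<Rightarrow> 'b::topological_space) \<Rightarrow> 'b \<Rightarrow> bool" where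
  "has_iterated_limit [] F l \<longleftrightarrow> l = F []"
| "has_iterated_limit (p # ps) F l \<longleftrightarrow>
    (\<exists>g. (\<forall>z. has_iterated_limit ps (\<lambda>zs. F (z # zs)) (g z)) \<and> (g \<longlongrightarrow> l) p)"


section \<open>Integer-valued polynomials\<close>

text \<open>Rational polynomials as finitely supported coefficient functions on monomials, a monomial
  being a finitely supported exponent function.  The variable \<open>(j, k)\<close> is the \<open>k\<close>-th coordinate
  of the \<open>j\<close>-th vector variable, both counted from 0.\<close>

type_synonym rat_mpoly = "((nat \<times> nat) \<Rightarrow>\<^sub>0 nat) \<Rightarrow>\<^sub>0 rat"

definition poly_eval :: "rat_mpoly \<Rightarrow> (nat \<times> nat \<Rightarrow> rat) \<Rightarrow> rat"
  where "poly_eval f a = (\<Sum>m\<in>Poly_Mapping.keys f. Poly_Mapping.lookup f m *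
    (\<Prod>v\<in>Poly_Mapping.keys m. a v ^ Poly_Mapping.lookup m v))"

definition poly_vars :: "rat_mpoly \<Rightarrow> (nat \<times> nat) set"
  where "poly_vars f = (\<Union>m\<in>Poly_Mapping.keys f. Poly_Mapping.keys m)"

definition int_valued_polys :: "nat \<Rightarrow> (nat \<Rightarrow> nat) \<Rightarrow> rat_mpoly set"
  where "int_valued_polys s n = {f.
    poly_vars f \<subseteq> {(j, k). j < s \<and> k < n j} \<and>
    (\<forall>a :: nat \<times> nat \<Rightarrow> int. poly_eval f (\<lambda>v. of_int (a v)) \<in> \<int>)}"

text \<open>For integer-valued \<open>f\<close> the floor only converts the type.\<close>

definition int_poly_eval :: "rat_mpoly \<Rightarrow> (nat \<Rightarrow>\<^sub>0 int) list \<Rightarrow> int"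
  where "int_poly_eval f zs =
    \<lfloor>poly_eval f (\<lambda>(j, k). of_int (Poly_Mapping.lookup (zs ! j) k))\<rfloor>"


section \<open>Iterated weak operator limits along polynomials\<close>

definition limit_data ::
    "nat \<Rightarrow> nat \<Rightarrow> (nat \<Rightarrow> nat) \<Rightarrow> (nat \<Rightarrow> (nat \<Rightarrow>\<^sub>0 int) filter) \<Rightarrow> (nat \<Rightarrow> rat_mpoly) \<Rightarrow> bool"
  where "limit_data m s n p f \<longleftrightarrow>
    s \<ge> 1 \<and> (\<forall>j<s. n j \<ge> 1 \<and> idempotent_ultrafilter (n j) (p j)) \<and>
    (\<forall>i<m. f i \<in> int_valued_polys s n \<and> poly_eval (f i) (\<lambda>_. 0) = 0)"

definition poly_op_product ::
    "(nat \<Rightarrow> 'a \<Rightarrow> 'a) \<Rightarrow> nat \<Rightarrow> (nat \<Rightarrow> rat_mpoly) \<Rightarrow> (nat \<Rightarrow>\<^sub>0 int) list \<Rightarrow> 'a \<Rightarrow> 'a"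
  where "poly_op_product U m f zs =
    foldr (\<circ>) (map (\<lambda>i. int_power (U i) (int_poly_eval (f i) zs)) [0..<m]) id"

definition is_iterated_weak_limit ::
    "(nat \<Rightarrow> 'a::complex_hilbert_space \<Rightarrow> 'a) \<Rightarrow> nat \<Rightarrow> nat \<Rightarrow> (nat \<Rightarrow> (nat \<Rightarrow>\<^sub>0 int) filter) \<Rightarrow>
     (nat \<Rightarrow> rat_mpoly) \<Rightarrow> ('a \<Rightarrow> 'a) \<Rightarrow> bool"
  where "is_iterated_weak_limit U m s p f P \<longleftrightarrow> bounded_clinear P \<and>
    (\<forall>x y. has_iterated_limit (map p [0..<s])
      (\<lambda>zs. cinner (poly_op_product U m f zs x) y) (cinner (P x) y))"

end

theory Submission
  imports Defs "HOL-Library.Function_Algebras"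
begin

text \<open>
  Along an ultrafilter, bounded families of operators have weak limits (compactness together with the
  Riesz representation), and a weak limit of commuting unitaries is a contraction that commutes with
  every operator commuting with the family.  This settles existence, uniqueness and
  commutation.  What has to be shown is \<open>P (P x) = P x\<close>, since an idempotent contraction is an orthogonal
  projection.

  For a linear exponent \<open>f\<close> and a single ultrafilter this is immediate from the idempotence of the
  ultrafilter.  In general there are two ingredients.

  The first is the van der Corput lemma for idempotent ultrafilters (\<open>van_der_Corput\<close>), used in an
  induction on the degree (\<open>polynomial_limit_projection\<close>): the limit of the
  unitaries with exponent \<open>f (z + w) - f z - f w\<close>, first in \<open>z\<close> and then in \<open>w\<close>, is a projection \<open>Q'\<close>;
  on its kernel \<open>P\<close> vanishes, and on its range \<open>f\<close> behaves like a homomorphism.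

  The second ingredient shows that such a limit of projections is again a projection, which is false
  for arbitrary commuting projections (\<open>limit_of_projections\<close>).  It rests on finite generation: for a
  fixed parameter \<open>w\<close>, the exponents are functions that lie in one finitely generated
  group independent of \<open>w\<close>; a vector is fixed by the projection belonging to such a function if and only if the
  unitaries converge strongly to the identity on it, so the functions fixing a given vector
  form a subgroup, and subgroups of finitely generated abelian groups satisfy the ascending chain
  condition.

  Iterated limits are limits along the tensor product of the ultrafilters.  By the second ingredient
  and induction on the number of ultrafilters, they reduce to the case of a single ultrafilter
  (\<open>iterated_polynomial_limit_projection\<close>).
\<close>

section \<open>Complex Hilbert spaces\<close>

lemma cinner_add_right: "cinner x (y + z) = cinner x y + cinner x z"
  for x y z :: "'a::complex_hilbert_space"
  by (metis cinner_add_left cinner_commute complex_cnj_add)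

lemma cinner_scaleC_right: "cinner x (c *\<^sub>C y) = cnj c * cinner x y"
  for x y :: "'a::complex_hilbert_space"
  by (metis cinner_scaleC_left cinner_commute complex_cnj_mult)

lemma cinner_scaleR_left: "cinner (r *\<^sub>R x) y = of_real r * cinner x y"
  for x y :: "'a::complex_hilbert_space"
  by (metis cinner_scaleC_left scaleC_of_real)

lemma cinner_scaleR_right: "cinner x (r *\<^sub>R y) = of_real r * cinner x y"
  for x y :: "'a::complex_hilbert_space"
  by (metis cinner_scaleC_right scaleC_of_real complex_cnj_complex_of_real)

lemma cinner_zero [simp]: "cinner 0 x = 0" "cinner x 0 = 0"
  for x :: "'a::complex_hilbert_space"
  using cinner_scaleR_left[of 0 0 x] cinner_scaleR_right[of x 0 0] by simp_all

lemma cinner_minus_left: "cinner (- x) y = - cinner x y"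
  and cinner_minus_right: "cinner x (- y) = - cinner x y"
  for x y :: "'a::complex_hilbert_space"
  using cinner_scaleR_left[of "-1" x y] cinner_scaleR_right[of x "-1" y] by simp_all

lemma cinner_diff_left: "cinner (x - y) z = cinner x z - cinner y z"
  and cinner_diff_right: "cinner x (y - z) = cinner x y - cinner x z"
  for x y z :: "'a::complex_hilbert_space"
  using cinner_add_left[of x "- y" z] cinner_add_right[of x y "- z"]
  by (simp_all add: cinner_minus_left cinner_minus_right)

lemma Re_cinner_commute: "Re (cinner y x) = Re (cinner x y)"
  for x y :: "'a::complex_hilbert_space"
  by (subst cinner_commute) simp

lemma norm_squared_eq_cinner: "(norm x)\<^sup>2 = Re (cinner x x)"
  for x :: "'a::complex_hilbert_space"
  by (simp add: cinner_self)

lemma cinner_eq_zero_iff: "cinner x x = 0 \<longleftrightarrow> x = 0"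
  for x :: "'a::complex_hilbert_space"
  by (simp add: cinner_self)

lemma norm_add_squared: "(norm (x + y))\<^sup>2 = (norm x)\<^sup>2 + (norm y)\<^sup>2 + 2 * Re (cinner x y)"
  for x y :: "'a::complex_hilbert_space"
  by (simp add: norm_squared_eq_cinner cinner_add_left cinner_add_right Re_cinner_commute[of x y])

lemma norm_diff_squared: "(norm (x - y))\<^sup>2 = (norm x)\<^sup>2 + (norm y)\<^sup>2 - 2 * Re (cinner x y)"
  for x y :: "'a::complex_hilbert_space"
  by (simp add: norm_squared_eq_cinner cinner_diff_left cinner_diff_right Re_cinner_commute[of x y])

lemma norm_scaleC: "norm (c *\<^sub>C x) = cmod c * norm x"
  for x :: "'a::complex_hilbert_space"
proof -
  have "complex_of_real ((norm (c *\<^sub>C x))\<^sup>2) = (c * cnj c) * cinner x x"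
    by (simp only: cinner_self[symmetric, of "c *\<^sub>C x"] cinner_scaleC_left cinner_scaleC_right
        mult.assoc mult.left_commute)
  also have "\<dots> = complex_of_real ((cmod c * norm x)\<^sup>2)"
    by (simp only: cinner_self complex_norm_square[symmetric] power_mult_distrib of_real_mult)
  finally have "(norm (c *\<^sub>C x))\<^sup>2 = (cmod c * norm x)\<^sup>2"
    using of_real_eq_iff by blast
  then show ?thesis
    by (simp add: power2_eq_iff_nonneg)
qed

lemma Re_cinner_le: "Re (cinner x y) \<le> norm x * norm y"
  for x y :: "'a::complex_hilbert_space"
proof -
  have "(norm (x + y))\<^sup>2 \<le> (norm x + norm y)\<^sup>2"
    by (intro power_mono norm_triangle_ineq) simp
  then show ?thesis
    by (simp add: norm_add_squared power2_sum)
qed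

lemma cinner_Cauchy_Schwarz: "cmod (cinner x y) \<le> norm x * norm y"
  for x y :: "'a::complex_hilbert_space"
proof (cases "cinner x y = 0")
  case False
  define c where "c = cnj (sgn (cinner x y))"
  have c: "cmod c = 1"
    using False by (simp add: c_def norm_sgn)
  have "c * cinner x y = of_real (cmod (cinner x y))"
    using False complex_norm_square[of "cinner x y"]
    by (simp add: c_def sgn_eq field_simps power2_eq_square)
  then have "cmod (cinner x y) = Re (cinner (c *\<^sub>C x) y)"
    by (simp add: cinner_scaleC_left)
  also have "\<dots> \<le> norm x * norm y"
    using Re_cinner_le[of "c *\<^sub>C x" y] by (simp add: norm_scaleC c)
  finally show ?thesis .
qed simp

lemma bounded_bilinear_cinner: "bounded_bilinear (cinner :: 'a::complex_hilbert_space \<Rightarrow> _)"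
  by unfold_locales
    (auto simp: cinner_add_left cinner_add_right cinner_scaleR_left cinner_scaleR_right
      scaleR_conv_of_real intro!: exI[of _ 1] cinner_Cauchy_Schwarz)

lemmas tendsto_cinner = bounded_bilinear.tendsto[OF bounded_bilinear_cinner]

lemma eq_if_cinner_eq: "(\<And>y. cinner a y = cinner b y) \<Longrightarrow> a = b"
  for a b :: "'a::complex_hilbert_space"
  by (metis cinner_diff_left cinner_eq_zero_iff eq_iff_diff_eq_0)

text \<open>The representing vector minimises \<open>\<parallel>x\<parallel>\<^sup>2 - 2 Re (\<phi> x)\<close>.  By the parallelogram law a minimising sequence is
  Cauchy, and the derivative of the functional vanishes at its limit.\<close>

lemma Riesz_representation:
  fixes \<phi> :: "'a::complex_hilbert_space \<Rightarrow> complex"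
  assumes add: "\<And>x y. \<phi> (x + y) = \<phi> x + \<phi> y"
    and scale: "\<And>c x. \<phi> (c *\<^sub>C x) = c * \<phi> x"
    and bound: "\<And>x. cmod (\<phi> x) \<le> K * norm x"
  shows "\<exists>v. \<forall>x. \<phi> x = cinner x v"
proof -
  define J where "J x = (norm x)\<^sup>2 - 2 * Re (\<phi> x)" for x
  have scaleR: "\<phi> (r *\<^sub>R x) = of_real r * \<phi> x" for r x
    using scale[of "of_real r" x] by (simp add: scaleC_of_real)
  have J_bound: "J x \<ge> - K\<^sup>2" for x
  proof -
    have "Re (\<phi> x) \<le> K * norm x"
      using bound[of x] complex_Re_le_cmod[of "\<phi> x"] by linarith
    moreover have "0 \<le> (norm x - K)\<^sup>2"
      by simp
    ultimately show ?thesis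
      by (simp add: J_def power2_diff algebra_simps)
  qed
  define d where "d = (INF x. J x)"
  have bdd: "bdd_below (range J)"
    using J_bound by (intro bdd_belowI[of _ "- K\<^sup>2"]) auto
  have d_le: "d \<le> J x" for x
    unfolding d_def by (rule cINF_lower[OF bdd]) simp
  have "\<exists>x. J x < d + inverse (real (Suc n))" for n
    using cINF_less_iff[of UNIV J "d + inverse (real (Suc n))"] bdd by (auto simp: d_def)
  then obtain x where x: "\<And>n. J (x n) < d + inverse (real (Suc n))"
    by metis
  have parallelogram: "(norm (a - b))\<^sup>2 \<le> 2 * (J a - d) + 2 * (J b - d)" for a b
  proof -
    have "J ((1/2) *\<^sub>R (a + b)) = (norm (a + b))\<^sup>2 / 4 - Re (\<phi> (a + b))"
      unfolding J_def by (simp only: scaleR norm_scaleR power_mult_distrib)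
        (simp add: power2_eq_square)
    then have "4 * J ((1/2) *\<^sub>R (a + b)) = (norm (a + b))\<^sup>2 - 4 * Re (\<phi> a) - 4 * Re (\<phi> b)"
      by (simp add: add)
    then have "(norm (a - b))\<^sup>2 = 2 * J a + 2 * J b - 4 * J ((1/2) *\<^sub>R (a + b))"
      by (simp add: J_def norm_add_squared norm_diff_squared)
    with d_le[of "(1/2) *\<^sub>R (a + b)"] show ?thesis
      by simp
  qed
  have "Cauchy x"
  proof (rule metric_CauchyI)
    fix e :: real assume "e > 0"
    then have "e\<^sup>2 / 4 > 0"
      by simp
    then obtain N where N: "inverse (real (Suc N)) < e\<^sup>2 / 4"
      using reals_Archimedean by blast
    have "dist (x m) (x n) < e" if "m \<ge> N" "n \<ge> N" for m n
    proof -
      have le: "J (x k) - d < e\<^sup>2 / 4" if "k \<ge> N" for k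
      proof -
        have "inverse (real (Suc k)) \<le> inverse (real (Suc N))"
          using that by (simp add: le_imp_inverse_le)
        then show ?thesis
          using x[of k] N by linarith
      qed
      have "(dist (x m) (x n))\<^sup>2 < e\<^sup>2"
        using parallelogram[of "x m" "x n"] le[OF that(1)] le[OF that(2)] by (simp add: dist_norm)
      then show ?thesis
        using \<open>e > 0\<close> by (simp add: power2_less_imp_less)
    qed
    then show "\<exists>M. \<forall>m\<ge>M. \<forall>n\<ge>M. dist (x m) (x n) < e"
      by blast
  qed
  then obtain v where v: "x \<longlonglongrightarrow> v"
    using Cauchy_convergent convergentD by blast
  have "bounded_linear \<phi>"
    by (rule bounded_linear_intro[where K = K])
      (simp_all add: add scaleR scaleR_conv_of_real bound mult.commute)
  then have "(\<lambda>n. \<phi> (x n)) \<longlonglongrightarrow> \<phi> v"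
    using v by (rule bounded_linear.tendsto)
  then have "(\<lambda>n. J (x n)) \<longlonglongrightarrow> J v"
    unfolding J_def by (intro tendsto_intros v)
  moreover have "(\<lambda>n. d + inverse (real (Suc n))) \<longlonglongrightarrow> d + 0"
    by (intro tendsto_intros LIMSEQ_inverse_real_of_nat)
  ultimately have "J v \<le> d + 0"
    using x by (intro LIMSEQ_le) (auto intro!: exI[of _ 0] less_imp_le)
  then have min: "J v \<le> J h" for h
    using d_le[of h] by simp
  \<comment> \<open>The first variation at the minimiser \<open>v\<close> in direction \<open>h\<close> is \<open>2 b\<close>.\<close>
  have Re_eq: "Re (\<phi> h) = Re (cinner h v)" for h
  proof -
    define b where "b = Re (cinner v h) - Re (\<phi> h)"
    have quad: "0 \<le> t\<^sup>2 * (norm h)\<^sup>2 + 2 * t * b" for t :: real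
    proof -
      have "J (v + t *\<^sub>R h) = J v + t\<^sup>2 * (norm h)\<^sup>2 + 2 * t * b"
        by (simp add: J_def norm_add_squared cinner_scaleR_right add scaleR b_def
            power_mult_distrib algebra_simps)
      with min[of "v + t *\<^sub>R h"] show ?thesis by simp
    qed
    have "b = 0"
    proof (cases "norm h = 0")
      case True
      with quad[of 1] quad[of "-1"] show ?thesis by simp
    next
      case False
      have "0 \<le> (- b / (norm h)\<^sup>2)\<^sup>2 * (norm h)\<^sup>2 + 2 * (- b / (norm h)\<^sup>2) * b"
        by (rule quad)
      also have "\<dots> = - (b\<^sup>2 / (norm h)\<^sup>2)"
        using False by (simp add: field_simps power2_eq_square)
      finally have "b\<^sup>2 / (norm h)\<^sup>2 \<le> 0"
        by simp
      then show ?thesis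
        using False by (simp add: divide_le_0_iff)
    qed
    then show ?thesis
      by (simp add: b_def Re_cinner_commute[of h v])
  qed
  have "\<phi> h = cinner h v" for h
  proof (rule complex_eqI)
    show "Re (\<phi> h) = Re (cinner h v)" by (rule Re_eq)
    have "Re (\<phi> (\<i> *\<^sub>C h)) = Re (cinner (\<i> *\<^sub>C h) v)" by (rule Re_eq)
    then show "Im (\<phi> h) = Im (cinner h v)"
      by (simp add: scale cinner_scaleC_left)
  qed
  then show ?thesis by blast
qed

section \<open>Contractions and projections\<close>

definition ccontraction :: "('a::complex_hilbert_space \<Rightarrow> 'a) \<Rightarrow> bool"
  where "ccontraction T \<longleftrightarrow> (\<forall>x y. T (x + y) = T x + T y) \<and> (\<forall>c x. T (c *\<^sub>C x) = c *\<^sub>C T x) \<and>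
    (\<forall>x. norm (T x) \<le> norm x)"

lemma ccontractionD:
  assumes "ccontraction T"
  shows "T (x + y) = T x + T y" "T (c *\<^sub>C x) = c *\<^sub>C T x" "norm (T x) \<le> norm x"
    "T (x - y) = T x - T y" "T 0 = 0"
proof -
  show add: "T (x + y) = T x + T y" for x y
    using assms by (simp add: ccontraction_def)
  show "T (c *\<^sub>C x) = c *\<^sub>C T x" "norm (T x) \<le> norm x"
    using assms by (simp_all add: ccontraction_def)
  show "T 0 = 0" using add[of 0 0] by simp
  show "T (x - y) = T x - T y" using add[of "x - y" y] by simp
qed

lemma ccontraction_imp_bounded_clinear: "ccontraction T \<Longrightarrow> bounded_clinear T"
  unfolding bounded_clinear_def
  by (auto simp: ccontractionD simp flip: scaleC_of_real intro!: bounded_linear_intro[where K = 1])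

lemma ccontraction_comp: "ccontraction S \<Longrightarrow> ccontraction T \<Longrightarrow> ccontraction (S \<circ> T)"
  unfolding ccontraction_def comp_def by (metis order_trans)

lemma ccontraction_id: "ccontraction id"
  by (simp add: ccontraction_def)

lemma adjoint_exists:
  fixes S :: "'a::complex_hilbert_space \<Rightarrow> 'a"
  assumes "ccontraction S"
  shows "\<exists>v. \<forall>x. cinner (S x) y = cinner x v"
proof (rule Riesz_representation[where K = "norm y"])
  show "cmod (cinner (S x) y) \<le> norm y * norm x" for x
    using cinner_Cauchy_Schwarz[of "S x" y] mult_right_mono[OF ccontractionD(3)[OF assms, of x], of "norm y"]
    by (simp add: mult.commute)
qed (simp_all add: ccontractionD[OF assms] cinner_add_left cinner_scaleC_left)

text \<open>This turns limits of matrix coefficients into operators: the Riesz representation is applied to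
  each antilinear functional \<open>\<beta> x\<close>.\<close>

lemma ccontraction_of_form:
  fixes \<beta> :: "'a::complex_hilbert_space \<Rightarrow> 'a \<Rightarrow> complex"
  assumes "\<And>x x' y. \<beta> (x + x') y = \<beta> x y + \<beta> x' y"
    and "\<And>c x y. \<beta> (c *\<^sub>C x) y = c * \<beta> x y"
    and "\<And>x y y'. \<beta> x (y + y') = \<beta> x y + \<beta> x y'"
    and "\<And>c x y. \<beta> x (c *\<^sub>C y) = cnj c * \<beta> x y"
    and bound: "\<And>x y. cmod (\<beta> x y) \<le> norm x * norm y"
  shows "\<exists>T. ccontraction T \<and> (\<forall>x y. cinner (T x) y = \<beta> x y)"
proof -
  have "\<exists>v. \<forall>y. cnj (\<beta> x y) = cinner y v" for x
    by (rule Riesz_representation[where K = "norm x"]) (simp_all add: assms)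
  then obtain T where T: "\<And>x y. cnj (\<beta> x y) = cinner y (T x)"
    by metis
  then have eq: "cinner (T x) y = \<beta> x y" for x y
    by (metis cinner_commute complex_cnj_cnj)
  have "norm (T x) \<le> norm x" for x
  proof -
    have "(norm (T x))\<^sup>2 \<le> norm x * norm (T x)"
      using bound[of x "T x"] by (simp add: eq[symmetric] cinner_self norm_power)
    then show ?thesis
      by (cases "norm (T x) = 0") (auto simp: power2_eq_square)
  qed
  moreover have "T (x + x') = T x + T x'" "T (c *\<^sub>C x) = c *\<^sub>C T x" for c x x'
    by (rule eq_if_cinner_eq, simp add: eq cinner_add_left cinner_scaleC_left assms)+
  ultimately have "ccontraction T"
    unfolding ccontraction_def by blast
  with eq show ?thesis by blast
qed

text \<open>For an idempotent contraction, self-adjointness is automatic.  In this form, being a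
  projection only requires the equation \<open>P (P x) = P x\<close>, since weak limits of unitaries are always
  contractions.\<close>

definition idem_contraction :: "('a::complex_hilbert_space \<Rightarrow> 'a) \<Rightarrow> bool"
  where "idem_contraction P \<longleftrightarrow> ccontraction P \<and> (\<forall>x. P (P x) = P x)"

text \<open>If \<open>u\<close> in the kernel and \<open>v\<close> in the range had a nonzero inner product, then for a suitable
  scalar \<open>t\<close> the vector \<open>u + t v\<close> would be shorter than its image \<open>t v\<close>.\<close>

lemma idem_contraction_orthogonal:
  assumes "idem_contraction P"
  shows "cinner (x - P x) (P y) = 0"
proof (rule ccontr)
  have P: "ccontraction P" and idem: "P (P z) = P z" for z
    using assms by (auto simp: idem_contraction_def)
  define u v a where "u = x - P x" and "v = P y" and "a = cinner u v"
  assume "cinner (x - P x) (P y) \<noteq> 0"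
  then have a: "a \<noteq> 0" by (simp add: a_def u_def v_def)
  have quad: "0 \<le> (norm u)\<^sup>2 + 2 * Re (cnj t * a)" for t
  proof -
    have "P (u + t *\<^sub>C v) = t *\<^sub>C v"
      by (simp add: u_def v_def ccontractionD[OF P] idem)
    then have "norm (t *\<^sub>C v) \<le> norm (u + t *\<^sub>C v)"
      using ccontractionD(3)[OF P, of "u + t *\<^sub>C v"] by simp
    then have "(norm (t *\<^sub>C v))\<^sup>2 \<le> (norm (u + t *\<^sub>C v))\<^sup>2"
      by (intro power_mono) auto
    then show ?thesis
      by (simp add: norm_add_squared cinner_scaleC_right a_def)
  qed
  \<comment> \<open>This scalar makes the right-hand side of \<open>quad\<close> negative.\<close>
  define t where "t = of_real (- ((norm u)\<^sup>2 + 1) / (cmod a)\<^sup>2) * a"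
  have "cnj t * a = of_real (- ((norm u)\<^sup>2 + 1) / (cmod a)\<^sup>2) * of_real ((cmod a)\<^sup>2)"
    using complex_norm_square[of a] by (simp add: t_def mult.assoc mult.commute[of a])
  also have "\<dots> = of_real (- ((norm u)\<^sup>2 + 1))"
    using a by (simp flip: of_real_mult)
  finally have "Re (cnj t * a) = - ((norm u)\<^sup>2 + 1)"
    by simp
  with quad[of t] show False
    by (smt (verit) zero_le_power2)
qed

lemma idem_contraction_selfadjoint:
  assumes "idem_contraction P"
  shows "cinner (P x) y = cinner x (P y)"
proof -
  have "cinner x (P y) = cinner (P x) (P y)"
    using idem_contraction_orthogonal[OF assms, of x y] by (simp add: cinner_diff_left)
  moreover have "cinner y (P x) = cinner (P y) (P x)"
    using idem_contraction_orthogonal[OF assms, of y x] by (simp add: cinner_diff_left)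
  ultimately show ?thesis
    by (metis cinner_commute)
qed

lemma idem_contraction_norm: "idem_contraction P \<Longrightarrow> (norm (P x))\<^sup>2 = Re (cinner (P x) x)"
  by (metis idem_contraction_def idem_contraction_selfadjoint norm_squared_eq_cinner)

lemma idem_contraction_imp_orthogonal_projection:
  assumes "idem_contraction P"
  shows "orthogonal_projection P"
  unfolding orthogonal_projection_def
proof (intro exI[of _ "{x. P x = x}"] conjI allI ballI)
  have P: "ccontraction P" and idem: "P (P z) = P z" for z
    using assms by (auto simp: idem_contraction_def)
  have "bounded_linear P"
    using ccontraction_imp_bounded_clinear[OF P] by (simp add: bounded_clinear_def)
  then show "closed_csubspace {x. P x = x}"
    unfolding closed_csubspace_def
    by (auto simp: ccontractionD[OF P] intro!: closed_Collect_eq linear_continuous_on continuous_on_id)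
  show "P x \<in> {x. P x = x}" for x
    by (simp add: idem)
  show "cinner (x - P x) y = 0" if "y \<in> {x. P x = x}" for x y
    using idem_contraction_orthogonal[OF assms, of x y] that by simp
qed

section \<open>Weak operator limits along ultrafilters\<close>

lemma ultrafilter_neq_bot: "ultrafilter p \<Longrightarrow> p \<noteq> bot"
  by (simp add: ultrafilter_def)

lemma ultrafilter_cases: "ultrafilter p \<Longrightarrow> eventually A p \<or> eventually (\<lambda>s. \<not> A s) p"
  by (drule ultrafilter_def[THEN iffD1, THEN conjunct2, THEN spec[where x = "Collect A"]]) simp

lemma ultrafilter_not: "ultrafilter p \<Longrightarrow> \<not> eventually A p \<Longrightarrow> eventually (\<lambda>s. \<not> A s) p"
  using ultrafilter_cases by blast

lemma ultrafilter_filtermap: "ultrafilter p \<Longrightarrow> ultrafilter (filtermap f p)"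
  unfolding ultrafilter_def
  by (auto simp: filtermap_bot_iff eventually_filtermap dest: spec[of _ "f -` _"])

lemma ultrafilter_compact_limit:
  assumes p: "ultrafilter p" and K: "compact K" and f: "\<And>z. f z \<in> K"
  shows "\<exists>l. (f \<longlongrightarrow> l) p"
proof -
  let ?F = "filtermap f p"
  have "?F \<noteq> bot" "eventually (\<lambda>x. x \<in> K) ?F"
    using ultrafilter_neq_bot[OF p] f by (simp_all add: filtermap_bot_iff eventually_filtermap)
  then obtain l where l: "inf (nhds l) ?F \<noteq> bot"
    using K unfolding compact_filter by blast
  have "?F \<le> nhds l"
  proof (rule filter_leI)
    fix A assume A: "eventually A (nhds l)"
    show "eventually A ?F"
    proof (rule ccontr)
      assume "\<not> eventually A ?F"
      then have "eventually (\<lambda>x. \<not> A x) ?F"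
        by (rule ultrafilter_not[OF ultrafilter_filtermap[OF p]])
      with A have "eventually (\<lambda>x. False) (inf (nhds l) ?F)"
        unfolding eventually_inf by blast
      with l show False by simp
    qed
  qed
  then show ?thesis
    unfolding filterlim_def by blast
qed

lemma ultrafilter_bounded_limit:
  fixes f :: "'z \<Rightarrow> complex"
  assumes "ultrafilter p" and "\<And>z. cmod (f z) \<le> K"
  shows "\<exists>l. (f \<longlongrightarrow> l) p"
proof (rule ultrafilter_compact_limit[OF assms(1)])
  show "compact (cball (0::complex) K)"
    by (rule compact_cball)
  show "f z \<in> cball 0 K" for z
    using assms(2)[of z] by (simp add: dist_norm)
qed

definition weak_limit :: "'z filter \<Rightarrow> ('z \<Rightarrow> 'a::complex_hilbert_space \<Rightarrow> 'a) \<Rightarrow> ('a \<Rightarrow> 'a) \<Rightarrow> bool"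
  where "weak_limit p T P \<longleftrightarrow> (\<forall>x y. ((\<lambda>z. cinner (T z x) y) \<longlongrightarrow> cinner (P x) y) p)"

lemma weak_limitD: "weak_limit p T P \<Longrightarrow> ((\<lambda>z. cinner (T z x) y) \<longlongrightarrow> cinner (P x) y) p"
  by (simp add: weak_limit_def)

lemma weak_limit_unique:
  assumes "p \<noteq> bot" "weak_limit p T P" "weak_limit p T P'"
  shows "P = P'"
proof (rule ext, rule eq_if_cinner_eq)
  show "cinner (P x) y = cinner (P' x) y" for x y
    by (rule tendsto_unique[OF assms(1)]) (rule weak_limitD[OF assms(2)], rule weak_limitD[OF assms(3)])
qed

lemma weak_limit_exists:
  assumes p: "ultrafilter p" and T: "\<And>z. ccontraction (T z)"
  shows "\<exists>P. ccontraction P \<and> weak_limit p T P"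
proof -
  have bound: "cmod (cinner (T z x) y) \<le> norm x * norm y" for z x y
    using cinner_Cauchy_Schwarz[of "T z x" y]
      mult_right_mono[OF ccontractionD(3)[OF T, of z x], of "norm y"] by simp
  have "\<exists>l. ((\<lambda>z. cinner (T z x) y) \<longlongrightarrow> l) p" for x y
    by (rule ultrafilter_bounded_limit[OF p bound])
  then obtain \<beta> where \<beta>: "\<And>x y. ((\<lambda>z. cinner (T z x) y) \<longlongrightarrow> \<beta> x y) p"
    by metis
  note unique = tendsto_unique[OF ultrafilter_neq_bot[OF p]]
  have "\<exists>P. ccontraction P \<and> (\<forall>x y. cinner (P x) y = \<beta> x y)"
  proof (rule ccontraction_of_form)
    fix x x' y y' c
    show "\<beta> (x + x') y = \<beta> x y + \<beta> x' y"
      using \<beta>[of "x + x'" y] tendsto_add[OF \<beta>[of x y] \<beta>[of x' y]]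
      by (intro unique) (simp_all add: ccontractionD[OF T] cinner_add_left)
    show "\<beta> (c *\<^sub>C x) y = c * \<beta> x y"
      using \<beta>[of "c *\<^sub>C x" y] tendsto_mult_left[OF \<beta>[of x y], of c]
      by (intro unique) (simp_all add: ccontractionD[OF T] cinner_scaleC_left)
    show "\<beta> x (y + y') = \<beta> x y + \<beta> x y'"
      using \<beta>[of x "y + y'"] tendsto_add[OF \<beta>[of x y] \<beta>[of x y']]
      by (intro unique) (simp_all add: cinner_add_right)
    show "\<beta> x (c *\<^sub>C y) = cnj c * \<beta> x y"
      using \<beta>[of x "c *\<^sub>C y"] tendsto_mult_left[OF \<beta>[of x y], of "cnj c"]
      by (intro unique) (simp_all add: cinner_scaleC_right)
    show "cmod (\<beta> x y) \<le> norm x * norm y"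
    proof (rule tendsto_upperbound)
      show "((\<lambda>z. cmod (cinner (T z x) y)) \<longlongrightarrow> cmod (\<beta> x y)) p"
        by (intro tendsto_norm \<beta>)
    qed (simp_all add: bound ultrafilter_neq_bot[OF p])
  qed
  with \<beta> show ?thesis
    unfolding weak_limit_def by metis
qed

lemma weak_limit_ccontraction:
  assumes "ultrafilter p" "\<And>z. ccontraction (T z)" "weak_limit p T P"
  shows "ccontraction P"
proof -
  obtain P' where "ccontraction P'" "weak_limit p T P'"
    using weak_limit_exists[of p T] assms(1,2) by blast
  then show ?thesis
    using weak_limit_unique[OF ultrafilter_neq_bot[OF assms(1)] assms(3)] by blast
qed

lemma weak_limit_apply:
  assumes "ccontraction S" "weak_limit p T P"
  shows "((\<lambda>z. cinner (S (T z x)) y) \<longlongrightarrow> cinner (S (P x)) y) p"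
proof -
  obtain v where "\<And>x. cinner (S x) y = cinner x v"
    using adjoint_exists[OF assms(1)] by blast
  then show ?thesis
    using weak_limitD[OF assms(2), of x v] by simp
qed

lemma weak_limit_commute:
  assumes p: "p \<noteq> bot" and S: "ccontraction S" and lim: "weak_limit p T P"
    and comm: "\<And>z x. T z (S x) = S (T z x)"
  shows "P (S x) = S (P x)"
proof (rule eq_if_cinner_eq)
  fix y
  show "cinner (P (S x)) y = cinner (S (P x)) y"
    using weak_limitD[OF lim, of "S x" y] weak_limit_apply[OF S lim, of x y]
    by (intro tendsto_unique[OF p]) (simp_all add: comm)
qed

text \<open>For projections \<open>\<parallel>R x\<parallel>\<^sup>2 = \<langle>R x, x\<rangle>\<close>, so weak convergence to a projection
  preserves norms and is therefore strong.\<close>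

lemma strong_limit_projections:
  assumes R: "\<And>w. idem_contraction (R w)" and lim: "weak_limit q R T" and T: "idem_contraction T"
  shows "((\<lambda>w. R w x) \<longlongrightarrow> T x) q"
proof -
  have "(norm (R w x - T x))\<^sup>2 = Re (cinner (R w x) x) + Re (cinner (T x) x) - 2 * Re (cinner (R w x) (T x))" for w
    by (simp add: norm_diff_squared idem_contraction_norm[OF R] idem_contraction_norm[OF T])
  moreover have "((\<lambda>w. Re (cinner (R w x) x) + Re (cinner (T x) x) - 2 * Re (cinner (R w x) (T x)))
      \<longlongrightarrow> Re (cinner (T x) x) + Re (cinner (T x) x) - 2 * Re (cinner (T x) (T x))) q"
    by (intro tendsto_intros weak_limitD[OF lim])
  moreover have "Re (cinner (T x) (T x)) = Re (cinner (T x) x)"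
    using idem_contraction_norm[OF T, of x] by (simp add: norm_squared_eq_cinner)
  ultimately have "((\<lambda>w. (norm (R w x - T x))\<^sup>2) \<longlongrightarrow> 0) q"
    by simp
  then have "((\<lambda>w. sqrt ((norm (R w x - T x))\<^sup>2)) \<longlongrightarrow> sqrt 0) q"
    by (rule tendsto_real_sqrt)
  then show ?thesis
    by (simp add: tendsto_norm_zero_iff LIM_zero_iff)
qed

text \<open>Composition is not jointly continuous in the weak operator topology; strong convergence of the
  inner factor and boundedness of the outer one repair this.\<close>

lemma weak_limit_comp_strong:
  assumes V: "\<And>w. ccontraction (V w)" and lim: "weak_limit q V A"
    and strong: "\<And>x. ((\<lambda>w. R w x) \<longlongrightarrow> T x) q"
  shows "weak_limit q (\<lambda>w. V w \<circ> R w) (A \<circ> T)"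
  unfolding weak_limit_def
proof (intro allI)
  fix x y
  have "((\<lambda>w. V w (R w x - T x)) \<longlongrightarrow> 0) q"
    using tendsto_norm_zero[OF LIM_zero[OF strong[of x]]]
    by (rule Lim_null_comparison[rotated]) (simp add: ccontractionD(3)[OF V])
  then have "((\<lambda>w. cinner (V w (R w x - T x)) y + cinner (V w (T x)) y)
      \<longlongrightarrow> cinner 0 y + cinner (A (T x)) y) q"
    by (intro tendsto_add tendsto_cinner weak_limitD[OF lim] tendsto_const)
  then show "((\<lambda>w. cinner ((V w \<circ> R w) x) y) \<longlongrightarrow> cinner ((A \<circ> T) x) y) q"
    by (simp add: ccontractionD(4)[OF V] cinner_diff_left)
qed

section \<open>Ascending chains in finitely generated abelian groups\<close>

text \<open>The subgroup generated by \<open>B\<close>.\<close>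

inductive_set int_span :: "'g::ab_group_add set \<Rightarrow> 'g set" for B :: "'g set" where
  int_span_zero: "0 \<in> int_span B"
| int_span_base: "b \<in> B \<Longrightarrow> b \<in> int_span B"
| int_span_diff: "x \<in> int_span B \<Longrightarrow> y \<in> int_span B \<Longrightarrow> x - y \<in> int_span B"

lemma int_span_uminus: "x \<in> int_span B \<Longrightarrow> - x \<in> int_span B"
  using int_span_diff[OF int_span_zero, of x B] by simp

lemma int_span_add: "x \<in> int_span B \<Longrightarrow> y \<in> int_span B \<Longrightarrow> x + y \<in> int_span B"
  using int_span_diff[of x B "- y"] int_span_uminus[of y B] by simp

lemma int_span_least:
  assumes "B \<subseteq> int_span C"
  shows "int_span B \<subseteq> int_span C"
proof
  fix x assume "x \<in> int_span B"
  then show "x \<in> int_span C"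
    by induction (use assms in \<open>auto intro: int_span.intros\<close>)
qed

lemma int_span_mono: "B \<subseteq> C \<Longrightarrow> int_span B \<subseteq> int_span C"
  by (intro int_span_least) (auto intro: int_span_base)

lemma int_span_int_span: "int_span (int_span B) = int_span B"
  by (meson int_span_least int_span_base subset_antisym subsetI)

lemma int_span_of_int_mult:
  fixes x :: "'g::comm_ring_1"
  assumes "x \<in> int_span B"
  shows "of_int k * x \<in> int_span B"
proof (induction k rule: int_induct[where k = 0])
  case base
  then show ?case by (simp add: int_span_zero)
next
  case (step1 i)
  then show ?case using int_span_add[OF _ assms] by (simp add: distrib_right)
next
  case (step2 i)
  then show ?case using int_span_diff[OF _ assms] by (simp add: left_diff_distrib)
qed

lemma int_span_insertE:
  fixes x :: "'g::comm_ring_1"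
  assumes "x \<in> int_span (insert b B)"
  obtains k where "x - of_int k * b \<in> int_span B"
proof -
  from assms have "\<exists>k. x - of_int k * b \<in> int_span B"
  proof induction
    case int_span_zero
    then show ?case by (intro exI[of _ 0]) (simp add: int_span.int_span_zero)
  next
    case (int_span_base c)
    show ?case
    proof (cases "c = b")
      case True
      then show ?thesis by (intro exI[of _ 1]) (simp add: int_span.int_span_zero)
    next
      case False
      then show ?thesis using int_span_base by (intro exI[of _ 0]) (simp add: int_span.int_span_base)
    qed
  next
    case (int_span_diff x y)
    then obtain k l where "x - of_int k * b \<in> int_span B" "y - of_int l * b \<in> int_span B" by blast
    from int_span.int_span_diff[OF this] show ?case
      by (intro exI[of _ "k - l"]) (simp add: algebra_simps)
  qed
  with that show ?thesis by blast
qed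

text \<open>Induction on the generators.  The possible coefficients at the last generator \<open>b\<close> of elements of \<open>H\<close>
  form a subgroup of the integers.  An element \<open>h0\<close> of \<open>H\<close> whose coefficient generates it, together
  with generators of the part of \<open>H\<close> in the span of the other generators, generates \<open>H\<close>.\<close>

lemma subgroup_of_fg_is_fg:
  fixes B H :: "'g::comm_ring_1 set"
  assumes "finite B" "H \<subseteq> int_span B" "int_span H = H"
  shows "\<exists>C. finite C \<and> H = int_span C"
  using assms
proof (induction B arbitrary: H rule: finite_induct)
  case empty
  have "int_span {} \<subseteq> {0::'g}"
  proof
    fix x :: 'g assume "x \<in> int_span {}"
    then show "x \<in> {0}" by induction auto
  qed
  then have "H = int_span {}"
    using empty int_span_zero by blast
  then show ?case by blast
next
  case (insert b B)
  have H_diff: "x - y \<in> H" if "x \<in> H" "y \<in> H" for x y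
    using that insert.prems(2) int_span_diff by metis
  have H_mult: "of_int k * x \<in> H" if "x \<in> H" for k x
    using that insert.prems(2) int_span_of_int_mult by metis
  define coefs where "coefs = {k. \<exists>h\<in>H. h - of_int k * b \<in> int_span B}"
  have coef: "\<exists>k\<in>coefs. h - of_int k * b \<in> int_span B" if h: "h \<in> H" for h
  proof -
    from h insert.prems(1) have "h \<in> int_span (insert b B)" by blast
    then obtain k where "h - of_int k * b \<in> int_span B" by (rule int_span_insertE)
    with h show ?thesis by (auto simp: coefs_def)
  qed
  have coefs_sub: "k - q * l \<in> coefs" if kl: "k \<in> coefs" "l \<in> coefs" for k l q
  proof -
    from kl obtain x y where xy: "x \<in> H" "x - of_int k * b \<in> int_span B"
      "y \<in> H" "y - of_int l * b \<in> int_span B"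
      by (auto simp: coefs_def)
    have "(x - of_int k * b) - of_int q * (y - of_int l * b) \<in> int_span B"
      by (intro int_span_diff int_span_of_int_mult xy)
    then have "(x - of_int q * y) - of_int (k - q * l) * b \<in> int_span B"
      by (simp add: algebra_simps)
    moreover have "x - of_int q * y \<in> H"
      by (intro H_diff H_mult xy)
    ultimately show ?thesis
      unfolding coefs_def by blast
  qed
  have "int_span (H \<inter> int_span B) = H \<inter> int_span B"
    using int_span_mono[of "H \<inter> int_span B" H] int_span_mono[of "H \<inter> int_span B" "int_span B"]
      insert.prems(2) int_span_int_span[of B] int_span_base by blast
  then obtain C where C: "finite C" "H \<inter> int_span B = int_span C"
    using insert.IH[of "H \<inter> int_span B"] by auto
  show ?case
  proof (cases "coefs \<subseteq> {0}")
    case True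
    then have "H \<subseteq> int_span B" using coef by fastforce
    then show ?thesis using C by (metis inf.absorb1)
  next
    case False
    then obtain k where k: "k \<in> coefs" "k \<noteq> 0" by blast
    have "0 \<in> coefs" using coefs_sub[OF k(1) k(1), of 1] by simp
    then have "- k \<in> coefs" using coefs_sub[of 0 k 1] k by simp
    then have ex: "\<exists>n::nat. n > 0 \<and> int n \<in> coefs"
      using k by (intro exI[of _ "nat \<bar>k\<bar>"]) (auto simp: abs_if)
    define n where "n = (LEAST n::nat. n > 0 \<and> int n \<in> coefs)"
    have n: "n > 0" "int n \<in> coefs"
      using LeastI_ex[OF ex] by (simp_all add: n_def)
    have multiple: "int n dvd l" if "l \<in> coefs" for l
    proof (rule ccontr)
      assume "\<not> int n dvd l"
      then have "l mod int n \<noteq> 0" by (simp add: dvd_eq_mod_eq_0)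
      moreover have "l mod int n \<in> coefs"
        using coefs_sub[OF that n(2), of "l div int n"] by (simp add: minus_div_mult_eq_mod)
      moreover have "0 \<le> l mod int n" "l mod int n < int n"
        using n(1) by simp_all
      ultimately have "nat (l mod int n) > 0 \<and> int (nat (l mod int n)) \<in> coefs"
        by simp
      then have "n \<le> nat (l mod int n)"
        unfolding n_def by (rule Least_le)
      then show False
        using \<open>l mod int n < int n\<close> \<open>0 \<le> l mod int n\<close> by linarith
    qed
    obtain h0 where h0: "h0 \<in> H" "h0 - of_int (int n) * b \<in> int_span B"
      using n(2) unfolding coefs_def by blast
    have "H \<subseteq> int_span (insert h0 C)"
    proof
      fix h assume h: "h \<in> H"
      then obtain l where l: "l \<in> coefs" "h - of_int l * b \<in> int_span B" using coef by blast
      then obtain q where q: "l = int n * q" using multiple by blast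
      have "(h - of_int l * b) - of_int q * (h0 - of_int (int n) * b) \<in> int_span B"
        by (intro int_span_diff int_span_of_int_mult h0 l)
      then have "h - of_int q * h0 \<in> int_span B"
        by (simp add: q algebra_simps)
      then have "h - of_int q * h0 \<in> int_span C"
        using H_diff[OF h H_mult[OF h0(1)]] C(2) by blast
      then have "(h - of_int q * h0) + of_int q * h0 \<in> int_span (insert h0 C)"
        using int_span_mono[of C "insert h0 C"]
        by (intro int_span_add int_span_of_int_mult) (auto intro: int_span_base)
      then show "h \<in> int_span (insert h0 C)" by simp
    qed
    moreover have "int_span (insert h0 C) \<subseteq> int_span H"
      using C(2) h0(1) int_span_base by (intro int_span_mono) blast
    ultimately show ?thesis
      using C(1) insert.prems(2) by (intro exI[of _ "insert h0 C"]) auto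
  qed
qed

lemma fg_ascending_chain:
  fixes B :: "'g::comm_ring_1 set"
  assumes "finite B" and c: "\<And>n::nat. c n \<in> int_span B"
  shows "\<exists>n. c n \<in> int_span (c ` {..<n})"
proof -
  have "int_span (range c) \<subseteq> int_span B"
    using c by (intro int_span_least) auto
  then obtain C where C: "finite C" "int_span (range c) = int_span C"
    using subgroup_of_fg_is_fg[OF assms(1) _ int_span_int_span] by blast
  have stage_mono: "x \<in> int_span (c ` {..<n})" if "x \<in> int_span (c ` {..<m})" "m \<le> n" for x m n
    using that int_span_mono[of "c ` {..<m}" "c ` {..<n}"] by fastforce
  have stage: "\<exists>n. x \<in> int_span (c ` {..<n})" if "x \<in> int_span (range c)" for x
    using that
  proof induction
    case int_span_zero
    then show ?case using int_span.int_span_zero by blast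
  next
    case (int_span_base b)
    then obtain n where "b = c n" by blast
    then show ?case by (intro exI[of _ "Suc n"] int_span.int_span_base) auto
  next
    case (int_span_diff x y)
    then obtain m n where "x \<in> int_span (c ` {..<m})" "y \<in> int_span (c ` {..<n})" by blast
    then have "x \<in> int_span (c ` {..<max m n})" "y \<in> int_span (c ` {..<max m n})"
      by (auto intro: stage_mono)
    then show ?case using int_span.int_span_diff by blast
  qed
  have "\<forall>x\<in>C. \<exists>n. x \<in> int_span (c ` {..<n})"
    using stage C(2) int_span_base by blast
  then obtain N where N: "\<And>x. x \<in> C \<Longrightarrow> x \<in> int_span (c ` {..<N x})"
    by metis
  define M where "M = Max (insert 0 (N ` C))"
  have "C \<subseteq> int_span (c ` {..<M})"
  proof
    fix x assume x: "x \<in> C"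
    have "N x \<le> M" using x C(1) by (auto simp: M_def)
    then show "x \<in> int_span (c ` {..<M})"
      using stage_mono[OF N[OF x]] by blast
  qed
  then have "c M \<in> int_span (c ` {..<M})"
    using int_span_least[of C] C(2) int_span_base[of "c M" "range c"] by blast
  then show ?thesis by blast
qed

text \<open>The ascending chain condition for the subgroups generated by finite subsets of \<open>F\<close>, in the form in
  which it is applied below.\<close>

definition noetherian_family :: "'g::ab_group_add set \<Rightarrow> bool"
  where "noetherian_family F \<longleftrightarrow>
    (\<forall>c :: nat \<Rightarrow> 'g. range c \<subseteq> F \<longrightarrow> (\<exists>n. c n \<in> int_span (c ` {..<n})))"

text \<open>The embedding serves to pass from integer-valued polynomials to rational polynomials, where
  monomials with a common denominator give an explicit finite set of generators.\<close>

lemma noetherian_family_if_embeds: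
  fixes \<iota> :: "'g::ab_group_add \<Rightarrow> 'r::comm_ring_1"
  assumes diff: "\<And>x y. \<iota> (x - y) = \<iota> x - \<iota> y" and inj: "inj \<iota>"
    and B: "finite B" "\<And>f. f \<in> F \<Longrightarrow> \<iota> f \<in> int_span B"
  shows "noetherian_family F"
  unfolding noetherian_family_def
proof (intro allI impI)
  fix c :: "nat \<Rightarrow> 'g" assume c: "range c \<subseteq> F"
  have zero: "\<iota> 0 = 0" using diff[of 0 0] by simp
  have pull: "\<exists>a\<in>int_span S. y = \<iota> a" if "y \<in> int_span (\<iota> ` S)" for y S
    using that
  proof induction
    case int_span_zero
    then show ?case using zero int_span.int_span_zero[of S] by metis
  next
    case (int_span_base b)
    then show ?case using int_span.int_span_base[of _ S] by blast
  next
    case (int_span_diff x y)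
    then obtain a b where "a \<in> int_span S" "b \<in> int_span S" "x = \<iota> a" "y = \<iota> b" by blast
    then show ?case using int_span.int_span_diff[of a S b] diff[of a b] by metis
  qed
  have "\<exists>n. \<iota> (c n) \<in> int_span ((\<lambda>i. \<iota> (c i)) ` {..<n})"
    using c B by (intro fg_ascending_chain[of B "\<lambda>i. \<iota> (c i)"]) auto
  then obtain n where "\<iota> (c n) \<in> int_span (\<iota> ` c ` {..<n})"
    by (auto simp: image_image)
  from pull[OF this] inj show "\<exists>n. c n \<in> int_span (c ` {..<n})"
    by (metis injD)
qed

text \<open>Families that lie in a finitely generated group are closed under pointwise sums and products;
  this is what makes all families built from polynomials Noetherian.\<close>

definition fg_family :: "('w \<Rightarrow> 'r::comm_ring_1) \<Rightarrow> bool"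
  where "fg_family F \<longleftrightarrow> (\<exists>B. finite B \<and> range F \<subseteq> int_span B)"

lemma fg_familyI: "finite B \<Longrightarrow> (\<And>w. F w \<in> int_span B) \<Longrightarrow> fg_family F"
  unfolding fg_family_def by blast

lemma fg_family_const: "fg_family (\<lambda>w. f)"
  by (rule fg_familyI[of "{f}"]) (auto intro: int_span_base)

lemma fg_family_of_int: "fg_family (\<lambda>w. of_int (k w))"
  using int_span_of_int_mult[OF int_span_base[of 1 "{1}"]] by (intro fg_familyI[of "{1}"]) auto

lemma fg_family_add:
  assumes "fg_family F" "fg_family G"
  shows "fg_family (\<lambda>w. F w + G w)"
proof -
  obtain A B where "finite A" "range F \<subseteq> int_span A" "finite B" "range G \<subseteq> int_span B"
    using assms unfolding fg_family_def by blast
  then show ?thesis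
    using int_span_mono[of A "A \<union> B"] int_span_mono[of B "A \<union> B"]
    by (intro fg_familyI[of "A \<union> B"] int_span_add) auto
qed

lemma int_span_mult:
  fixes x y :: "'r::comm_ring_1"
  assumes "x \<in> int_span A" "y \<in> int_span B"
  shows "x * y \<in> int_span {a * b |a b. a \<in> A \<and> b \<in> B}"
  using assms(1)
proof induction
  case int_span_zero
  then show ?case by (simp add: int_span.int_span_zero)
next
  case (int_span_base a)
  from assms(2) show ?case
  proof induction
    case int_span_zero
    then show ?case by (simp add: int_span.int_span_zero)
  next
    case (int_span_base b)
    then show ?case using \<open>a \<in> A\<close> by (auto intro: int_span.int_span_base)
  next
    case (int_span_diff x y)
    then show ?case by (simp add: right_diff_distrib int_span.int_span_diff)
  qed
next
  case (int_span_diff x y)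
  then show ?case by (simp add: left_diff_distrib int_span.int_span_diff)
qed

lemma fg_family_mult:
  assumes "fg_family F" "fg_family G"
  shows "fg_family (\<lambda>w. F w * G w)"
proof -
  obtain A B where "finite A" "range F \<subseteq> int_span A" "finite B" "range G \<subseteq> int_span B"
    using assms unfolding fg_family_def by blast
  moreover have "{a * b |a b. a \<in> A \<and> b \<in> B} = (\<lambda>(a, b). a * b) ` (A \<times> B)"
    by auto
  ultimately show ?thesis
    by (intro fg_familyI[of "{a * b |a b. a \<in> A \<and> b \<in> B}"] int_span_mult) auto
qed

lemma fg_family_sum:
  assumes "\<And>i. i \<in> I \<Longrightarrow> fg_family (F i)"
  shows "fg_family (\<lambda>w. \<Sum>i\<in>I. F i w)"
  using assms
  by (induction I rule: infinite_finite_induct) (simp_all add: fg_family_const fg_family_add)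

section \<open>Weak limits of commuting projections\<close>

text \<open>A weak limit \<open>T\<close> of commuting projections need not be a projection: it is a positive contraction
  that may take any spectral value between 0 and 1.  The ascending chain condition excludes this.

  Suppose \<open>T x \<noteq> 0\<close>.  As long as the \<open>q\<close>-typical \<open>R w\<close> does not fix the common range of the projections
  \<open>R w\<^sub>1, \<dots>, R w\<^sub>n\<close> chosen so far, another one can be chosen that does not fix it either, while
  \<open>T R w\<^sub>1 \<dots> R w\<^sub>n x\<close> stays nonzero, since \<open>\<langle>T (R w u), u\<rangle>\<close> converges to \<open>\<parallel>T u\<parallel>\<^sup>2\<close>.  By
  the chain condition this stops, with a projection \<open>e = R w\<^sub>1 \<dots> R w\<^sub>n\<close> such that \<open>T e = e\<close> and \<open>e x \<noteq> 0\<close>.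
  But \<open>T e = e\<close> gives \<open>e (T x - T (T x)) = 0\<close> for every \<open>x\<close>.  Hence \<open>T\<close> kills \<open>T x - T (T x)\<close>, and as \<open>T\<close> is
  self-adjoint this vector is zero.\<close>

lemma limit_of_projections:
  fixes R :: "'w \<Rightarrow> 'a::complex_hilbert_space \<Rightarrow> 'a"
  assumes q: "ultrafilter q" and R: "\<And>w. idem_contraction (R w)"
    and comm: "\<And>w w' x. R w (R w' x) = R w' (R w x)"
    and lim: "weak_limit q R T"
    and noeth: "\<And>\<omega> :: nat \<Rightarrow> 'w. \<exists>n. \<forall>x. (\<forall>i<n. R (\<omega> i) x = x) \<longrightarrow> R (\<omega> n) x = x"
  shows "idem_contraction T"
proof -
  have Rc: "ccontraction (R w)" and R_idem: "R w (R w x) = R w x" for w x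
    using R by (auto simp: idem_contraction_def)
  have Tc: "ccontraction T"
    by (rule weak_limit_ccontraction[OF q Rc lim])
  note q_bot = ultrafilter_neq_bot[OF q]
  have T_self: "cinner (T x) y = cinner x (T y)" for x y
  proof (rule tendsto_unique[OF q_bot weak_limitD[OF lim]])
    have "((\<lambda>w. cnj (cinner (R w y) x)) \<longlongrightarrow> cnj (cinner (T y) x)) q"
      by (intro tendsto_cnj weak_limitD[OF lim])
    then show "((\<lambda>w. cinner (R w x) y) \<longlongrightarrow> cinner x (T y)) q"
      by (simp add: cinner_commute[symmetric] idem_contraction_selfadjoint[OF R])
  qed
  have T_comm: "T (R w x) = R w (T x)" for w x
    by (rule weak_limit_commute[OF q_bot Rc lim]) (rule comm)
  define Rs where "Rs ws x = foldr R ws x" for ws x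
  have Rs_simps: "Rs [] x = x" "Rs (w # ws) x = R w (Rs ws x)" for w ws x
    by (simp_all add: Rs_def)
  have Rs_diff: "Rs ws (x - y) = Rs ws x - Rs ws y" for ws x y
    by (induction ws) (simp_all add: Rs_simps ccontractionD(4)[OF Rc])
  have Rs_T: "T (Rs ws x) = Rs ws (T x)" for ws x
    by (induction ws) (simp_all add: Rs_simps T_comm)
  have Rs_fixed: "R v (Rs ws x) = Rs ws x" if "v \<in> set ws" for v ws x
    using that
  proof (induction ws)
    case (Cons w ws)
    then show ?case by (cases "v = w") (auto simp: Rs_simps R_idem comm[of v w])
  qed simp
  have stable: "\<exists>ws. T (Rs ws x) \<noteq> 0 \<and>
      eventually (\<lambda>w. \<forall>y. (\<forall>v\<in>set ws. R v y = y) \<longrightarrow> R w y = y) q" (is "\<exists>ws. ?ok ws")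
    if x: "T x \<noteq> 0" for x
  proof (rule ccontr)
    assume none: "\<nexists>ws. ?ok ws"
    have "\<exists>w. T (R w (Rs ws x)) \<noteq> 0 \<and> (\<exists>y. (\<forall>v\<in>set ws. R v y = y) \<and> R w y \<noteq> y)"
      if nz: "T (Rs ws x) \<noteq> 0" for ws
    proof -
      let ?u = "Rs ws x"
      have "((\<lambda>w. cinner (T (R w ?u)) ?u) \<longlongrightarrow> cinner (T (T ?u)) ?u) q"
        by (rule weak_limit_apply[OF Tc lim])
      moreover have "cinner (T (T ?u)) ?u \<noteq> 0"
        using nz T_self[of "T ?u" ?u] by (simp add: cinner_eq_zero_iff)
      ultimately have "eventually (\<lambda>w. cinner (T (R w ?u)) ?u \<noteq> 0) q"
        by (rule tendsto_imp_eventually_ne)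
      moreover have "eventually (\<lambda>w. \<not> (\<forall>y. (\<forall>v\<in>set ws. R v y = y) \<longrightarrow> R w y = y)) q"
        using none nz by (intro ultrafilter_not[OF q]) blast
      ultimately have "eventually (\<lambda>w. cinner (T (R w ?u)) ?u \<noteq> 0 \<and>
          (\<exists>y. (\<forall>v\<in>set ws. R v y = y) \<and> R w y \<noteq> y)) q"
        by eventually_elim blast
      then obtain w where "cinner (T (R w ?u)) ?u \<noteq> 0" "\<exists>y. (\<forall>v\<in>set ws. R v y = y) \<and> R w y \<noteq> y"
        using eventually_happens'[OF q_bot] by blast
      then show ?thesis by (intro exI[of _ w]) auto
    qed
    then obtain f where f: "\<And>ws. T (Rs ws x) \<noteq> 0 \<Longrightarrow> T (R (f ws) (Rs ws x)) \<noteq> 0 \<and>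
        (\<exists>y. (\<forall>v\<in>set ws. R v y = y) \<and> R (f ws) y \<noteq> y)"
      by metis
    define L where "L = rec_nat [] (\<lambda>_ ws. f ws # ws)"
    have L: "L 0 = []" "L (Suc n) = f (L n) # L n" for n
      by (simp_all add: L_def)
    have nz: "T (Rs (L n) x) \<noteq> 0" for n
      by (induction n) (use x f in \<open>auto simp: L Rs_simps\<close>)
    have set_L: "set (L n) = (\<lambda>i. f (L i)) ` {..<n}" for n
      by (induction n) (auto simp: L lessThan_Suc)
    obtain n where n: "\<And>y. (\<forall>i<n. R (f (L i)) y = y) \<Longrightarrow> R (f (L n)) y = y"
      using noeth[of "\<lambda>i. f (L i)"] by blast
    from f[OF nz[of n]] n show False
      by (auto simp: set_L)
  qed
  have "T (T x) = T x" for x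
  proof (rule ccontr)
    assume neq: "T (T x) \<noteq> T x"
    define v where "v = T x - T (T x)"
    have v: "v = T (x - T x)" by (simp add: v_def ccontractionD(4)[OF Tc])
    have "T v = 0"
    proof (rule ccontr)
      assume "T v \<noteq> 0"
      then obtain ws where ws: "T (Rs ws v) \<noteq> 0"
        "eventually (\<lambda>w. \<forall>y. (\<forall>v\<in>set ws. R v y = y) \<longrightarrow> R w y = y) q"
        using stable by blast
      have TRs: "T (Rs ws y) = Rs ws y" for y
      proof (rule eq_if_cinner_eq)
        fix z
        have "eventually (\<lambda>w. cinner (R w (Rs ws y)) z = cinner (Rs ws y) z) q"
          using ws(2) by eventually_elim (simp add: Rs_fixed)
        then have "((\<lambda>w. cinner (R w (Rs ws y)) z) \<longlongrightarrow> cinner (Rs ws y) z) q"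
          by (rule tendsto_eventually)
        then show "cinner (T (Rs ws y)) z = cinner (Rs ws y) z"
          using tendsto_unique[OF q_bot weak_limitD[OF lim]] by blast
      qed
      have "Rs ws v = 0"
        by (simp add: v_def Rs_diff Rs_T[symmetric] TRs)
      with ws(1) show False by (simp add: ccontractionD(5)[OF Tc])
    qed
    then have "cinner v v = 0"
      using T_self[of "x - T x" v] by (simp add: v[symmetric])
    with neq show False by (simp add: cinner_eq_zero_iff v_def)
  qed
  with Tc show ?thesis by (simp add: idem_contraction_def)
qed

section \<open>Unitary representations of abelian groups\<close>

locale unitary_representation =
  fixes W :: "'v::ab_group_add \<Rightarrow> 'a::complex_hilbert_space \<Rightarrow> 'a"
  assumes W_contraction: "ccontraction (W v)"
    and W_add: "W (u + v) x = W u (W v x)"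
    and W_zero: "W 0 x = x"
begin

lemma W_norm: "norm (W v x) = norm x"
proof (rule antisym)
  show "norm (W v x) \<le> norm x"
    by (rule ccontractionD[OF W_contraction])
  have "x = W (- v) (W v x)"
    using W_add[of "- v" v x] by (simp add: W_zero)
  then show "norm x \<le> norm (W v x)"
    by (metis ccontractionD(3) W_contraction)
qed

lemma W_diff: "W v (x - y) = W v x - W v y"
  by (rule ccontractionD[OF W_contraction])

lemma W_commute: "W u (W v x) = W v (W u x)"
  by (metis W_add add.commute)

lemma W_distance: "norm (W u x - W v y) = norm (W (u - v) x - y)"
proof -
  have "W u x = W v (W (u - v) x)"
    using W_add[of v "u - v" x] by simp
  then show ?thesis
    using W_norm[of v "W (u - v) x - y"] by (simp add: W_diff)
qed

lemma W_cinner: "cinner (W u x) (W v y) = cinner (W (u - v) x) y"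
proof -
  have Re: "Re (cinner (W u x) (W v y)) = Re (cinner (W (u - v) x) y)" for x
    using W_distance[of u x v y] norm_diff_squared[of "W u x" "W v y"]
      norm_diff_squared[of "W (u - v) x" y] by (simp add: W_norm)
  show ?thesis
  proof (rule complex_eqI)
    show "Im (cinner (W u x) (W v y)) = Im (cinner (W (u - v) x) y)"
      using Re[of "\<i> *\<^sub>C x"] by (simp add: ccontractionD[OF W_contraction] cinner_scaleC_left)
  qed (rule Re)
qed

lemma displacement_limit:
  assumes "weak_limit \<pi> (\<lambda>y. W (\<psi> y)) R"
  shows "((\<lambda>y. (norm (W (\<psi> y) x - x))\<^sup>2) \<longlongrightarrow> 2 * (norm x)\<^sup>2 - 2 * Re (cinner (R x) x)) \<pi>"
proof -
  have "(norm (W (\<psi> y) x - x))\<^sup>2 = 2 * (norm x)\<^sup>2 - 2 * Re (cinner (W (\<psi> y) x) x)" for y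
    by (simp add: norm_diff_squared W_norm)
  moreover have "((\<lambda>y. 2 * (norm x)\<^sup>2 - 2 * Re (cinner (W (\<psi> y) x) x))
      \<longlongrightarrow> 2 * (norm x)\<^sup>2 - 2 * Re (cinner (R x) x)) \<pi>"
    by (intro tendsto_intros weak_limitD[OF assms])
  ultimately show ?thesis by simp
qed

text \<open>The range of the projection \<open>R\<close> is thus defined by strong convergence, a condition on \<open>\<psi>\<close> that
  is stable under differences.\<close>

lemma fixed_iff_strong_limit:
  assumes \<pi>: "\<pi> \<noteq> bot" and lim: "weak_limit \<pi> (\<lambda>y. W (\<psi> y)) R"
  shows "R x = x \<longleftrightarrow> ((\<lambda>y. norm (W (\<psi> y) x - x)) \<longlongrightarrow> 0) \<pi>"
proof
  assume "R x = x"
  then have "((\<lambda>y. (norm (W (\<psi> y) x - x))\<^sup>2) \<longlongrightarrow> 0) \<pi>"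
    using displacement_limit[OF lim, of x] by (simp add: norm_squared_eq_cinner)
  then have "((\<lambda>y. sqrt ((norm (W (\<psi> y) x - x))\<^sup>2)) \<longlongrightarrow> sqrt 0) \<pi>"
    by (rule tendsto_real_sqrt)
  then show "((\<lambda>y. norm (W (\<psi> y) x - x)) \<longlongrightarrow> 0) \<pi>"
    by simp
next
  assume "((\<lambda>y. norm (W (\<psi> y) x - x)) \<longlongrightarrow> 0) \<pi>"
  then have "((\<lambda>y. W (\<psi> y) x) \<longlongrightarrow> x) \<pi>"
    by (simp add: tendsto_norm_zero_iff LIM_zero_iff)
  then have "((\<lambda>y. cinner (W (\<psi> y) x) z) \<longlongrightarrow> cinner x z) \<pi>" for z
    by (intro tendsto_cinner tendsto_const)
  then show "R x = x"
    using tendsto_unique[OF \<pi> weak_limitD[OF lim]] eq_if_cinner_eq by metis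
qed

lemma strong_fixed_int_span:
  assumes gens: "\<And>\<psi>. \<psi> \<in> \<Psi> \<Longrightarrow> ((\<lambda>y. norm (W (\<psi> y) x - x)) \<longlongrightarrow> 0) \<pi>"
    and "\<psi> \<in> int_span \<Psi>"
  shows "((\<lambda>y. norm (W (\<psi> y) x - x)) \<longlongrightarrow> 0) \<pi>"
  using assms(2)
proof induction
  case int_span_zero
  then show ?case by (simp add: W_zero)
next
  case (int_span_base \<psi>)
  then show ?case by (rule gens)
next
  case (int_span_diff \<psi> \<psi>')
  have bound: "norm (W ((\<psi> - \<psi>') y) x - x) \<le> norm (W (\<psi> y) x - x) + norm (W (\<psi>' y) x - x)" for y
    using norm_triangle_ineq4[of "W (\<psi> y) x - x" "W (\<psi>' y) x - x"] W_distance[of "\<psi> y" x "\<psi>' y" x]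
    by simp
  have "((\<lambda>y. norm (W (\<psi> y) x - x) + norm (W (\<psi>' y) x - x)) \<longlongrightarrow> 0) \<pi>"
    using tendsto_add[OF int_span_diff.IH] by simp
  then show ?case
    by (rule Lim_null_comparison[rotated]) (intro always_eventually allI, use bound in simp)
qed

lemma weak_limit_commute_W:
  assumes "\<pi> \<noteq> bot" "weak_limit \<pi> (\<lambda>y. W (\<psi> y)) R"
  shows "R (W v x) = W v (R x)"
  by (rule weak_limit_commute[OF assms(1) W_contraction assms(2)]) (rule W_commute)

lemma weak_limits_commute:
  assumes "\<pi> \<noteq> bot" "weak_limit \<pi> (\<lambda>y. W (\<psi> y)) R"
    and "ultrafilter \<pi>'" "weak_limit \<pi>' (\<lambda>y. W (\<psi>' y)) R'"
  shows "R (R' x) = R' (R x)"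
proof (rule weak_limit_commute[OF assms(1) _ assms(2)])
  show "ccontraction R'"
    by (rule weak_limit_ccontraction[OF assms(3) _ assms(4)]) (rule W_contraction)
  show "W (\<psi> z) (R' x) = R' (W (\<psi> z) x)" for z x
    using weak_limit_commute_W[OF ultrafilter_neq_bot[OF assms(3)] assms(4)] by metis
qed

text \<open>If \<open>x\<close> is fixed by the limits belonging to some functions, then it is fixed by the limit belonging to
  any function in the group that these generate.  So a chain condition for the functions becomes one for
  the projections.\<close>

lemma limit_of_noetherian_family_projection:
  fixes \<Phi> :: "'w \<Rightarrow> 'y \<Rightarrow> 'v"
  assumes q: "ultrafilter q" and \<pi>: "ultrafilter \<pi>"
    and R: "\<And>w. weak_limit \<pi> (\<lambda>y. W (\<Phi> w y)) (R w)" "\<And>w. idem_contraction (R w)"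
    and \<Phi>: "noetherian_family F" "\<And>w. \<Phi> w \<in> F"
    and lim: "weak_limit q R T"
  shows "idem_contraction T"
proof (rule limit_of_projections[OF q R(2) _ lim])
  note \<pi>_bot = ultrafilter_neq_bot[OF \<pi>]
  show "R w (R w' x) = R w' (R w x)" for w w' x
    by (rule weak_limits_commute[OF \<pi>_bot R(1) \<pi> R(1)])
  fix \<omega> :: "nat \<Rightarrow> 'w"
  obtain n where n: "\<Phi> (\<omega> n) \<in> int_span ((\<lambda>i. \<Phi> (\<omega> i)) ` {..<n})"
    using \<Phi> unfolding noetherian_family_def by (metis (no_types, lifting) image_subsetI)
  have "R (\<omega> n) x = x" if fixed: "\<forall>i<n. R (\<omega> i) x = x" for x
    unfolding fixed_iff_strong_limit[OF \<pi>_bot R(1)]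
  proof (rule strong_fixed_int_span[OF _ n])
    fix \<psi> assume "\<psi> \<in> (\<lambda>i. \<Phi> (\<omega> i)) ` {..<n}"
    then obtain i where "i < n" "\<psi> = \<Phi> (\<omega> i)" by blast
    with fixed show "((\<lambda>y. norm (W (\<psi> y) x - x)) \<longlongrightarrow> 0) \<pi>"
      using fixed_iff_strong_limit[OF \<pi>_bot R(1), of "\<omega> i" x] by simp
  qed
  then show "\<exists>n. \<forall>x. (\<forall>i<n. R (\<omega> i) x = x) \<longrightarrow> R (\<omega> n) x = x" by blast
qed

end

section \<open>Idempotent ultrafilters and the van der Corput lemma\<close>

lemma eventually_idempotent:
  "filter_plus p p = p \<Longrightarrow> eventually A p \<Longrightarrow> \<forall>\<^sub>F s in p. \<forall>\<^sub>F t in p. A (s + t)"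
  using eventually_filter_plus[of A p p] by simp

text \<open>This refines a set \<open>A\<close> in an idempotent \<open>p\<close> to a set in \<open>p\<close> of elements that may be translated
  by \<open>p\<close>-typical elements without leaving the refined set.\<close>

definition shift_stable :: "'m::plus filter \<Rightarrow> ('m \<Rightarrow> bool) \<Rightarrow> 'm \<Rightarrow> bool"
  where "shift_stable p A s \<longleftrightarrow> A s \<and> (\<forall>\<^sub>F t in p. A (s + t))"

lemma eventually_shift_stable:
  "filter_plus p p = p \<Longrightarrow> eventually A p \<Longrightarrow> eventually (shift_stable p A) p"
  unfolding shift_stable_def using eventually_conj[OF _ eventually_idempotent] by blast

lemma shift_stable_translate:
  fixes p :: "'m::semigroup_add filter"
  assumes "filter_plus p p = p" "shift_stable p A s"
  shows "\<forall>\<^sub>F t in p. shift_stable p A (s + t)"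
  using assms(2) eventually_idempotent[OF assms(1), of "\<lambda>t. A (s + t)"]
  by (auto simp: shift_stable_def add.assoc intro: eventually_conj)

text \<open>With \<open>r = filter_plus p p\<close> and \<open>h = (+)\<close> this is the identity
  \<open>p-lim\<^sub>s p-lim\<^sub>t f (s + t) = (p + p)-lim f\<close>.\<close>

lemma limit_of_limits:
  fixes f :: "'z \<Rightarrow> 'b::metric_space"
  assumes f: "\<And>A. eventually A r \<Longrightarrow> \<forall>\<^sub>F s in p. \<forall>\<^sub>F t in q. A (h s t)"
    and q: "q \<noteq> bot" and lim: "(f \<longlongrightarrow> l) r" and inner: "\<And>s. ((\<lambda>t. f (h s t)) \<longlongrightarrow> g s) q"
  shows "(g \<longlongrightarrow> l) p"
proof (rule tendstoI)
  fix e :: real assume "e > 0"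
  then have "eventually (\<lambda>z. dist (f z) l < e / 2) r"
    by (intro tendstoD[OF lim]) simp
  then have "\<forall>\<^sub>F s in p. \<forall>\<^sub>F t in q. dist (f (h s t)) l < e / 2"
    by (rule f)
  then show "\<forall>\<^sub>F s in p. dist (g s) l < e"
  proof eventually_elim
    case (elim s)
    have "dist (g s) l \<le> e / 2"
      by (rule tendsto_upperbound[OF tendsto_dist[OF inner tendsto_const] _ q])
        (use elim in \<open>auto elim: eventually_mono\<close>)
    with \<open>e > 0\<close> show ?case by simp
  qed
qed

lemma eventually_sorted_wrt:
  assumes "sorted_wrt (\<lambda>b a. \<forall>\<^sub>F z in p. Q z b a) L"
  shows "\<forall>\<^sub>F z in p. sorted_wrt (Q z) L"
  using assms by (induction L) (auto intro!: eventually_conj eventually_ball_finite)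

text \<open>The points are the tail sums \<open>z\<^sub>i + \<dots> + z\<^sub>n\<close> of a sequence: choosing a new \<open>z\<close> translates all
  previous points by \<open>z\<close> and adds the point \<open>z\<close>.  Differences of old points do not change, and the
  differences to the new point are the old points themselves.  Idempotence is used
  through \<open>shift_stable\<close>, which keeps all the requirements intact under the translation by a typical \<open>z\<close>.\<close>

lemma tail_sums_exist:
  fixes p :: "'m::ab_group_add filter"
  assumes p: "p \<noteq> bot" "filter_plus p p = p"
    and A: "eventually A p" and E: "\<forall>\<^sub>F w in p. \<forall>\<^sub>F z in p. E w z"
  shows "\<exists>L. length L = n \<and> (\<forall>a\<in>set L. A a) \<and> sorted_wrt (\<lambda>b a. E (a - b) b) L"
proof -
  define G where "G w \<longleftrightarrow> A w \<and> (\<forall>\<^sub>F z in p. E w z)" for w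
  have G: "eventually G p"
    unfolding G_def using A E by (rule eventually_conj)
  have "\<exists>L. length L = n \<and> (\<forall>a\<in>set L. shift_stable p G a) \<and> sorted_wrt (\<lambda>b a. shift_stable p (E (a - b)) b) L"
  proof (induction n)
    case (Suc n)
    then obtain L where L: "length L = n" "\<forall>a\<in>set L. shift_stable p G a"
      "sorted_wrt (\<lambda>b a. shift_stable p (E (a - b)) b) L" by blast
    have "\<forall>\<^sub>F z in p. shift_stable p G z"
      by (rule eventually_shift_stable[OF p(2) G])
    moreover have "\<forall>\<^sub>F z in p. \<forall>a\<in>set L. shift_stable p G (a + z)"
      using L(2) shift_stable_translate[OF p(2)] by (intro eventually_ball_finite) auto
    moreover have "\<forall>\<^sub>F z in p. \<forall>a\<in>set L. shift_stable p (E a) z"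
      using L(2) by (intro eventually_ball_finite ballI eventually_shift_stable[OF p(2)])
        (auto simp: shift_stable_def G_def)
    moreover have "\<forall>\<^sub>F z in p. sorted_wrt (\<lambda>b a. shift_stable p (E (a - b)) (b + z)) L"
      using L(3) shift_stable_translate[OF p(2)]
      by (intro eventually_sorted_wrt) (auto elim: sorted_wrt_mono_rel[rotated])
    ultimately have "\<forall>\<^sub>F z in p. (\<forall>a\<in>set (z # map (\<lambda>a. a + z) L). shift_stable p G a) \<and>
        sorted_wrt (\<lambda>b a. shift_stable p (E (a - b)) b) (z # map (\<lambda>a. a + z) L)"
      by eventually_elim (simp add: sorted_wrt_map)
    then obtain z where "(\<forall>a\<in>set (z # map (\<lambda>a. a + z) L). shift_stable p G a) \<and>
        sorted_wrt (\<lambda>b a. shift_stable p (E (a - b)) b) (z # map (\<lambda>a. a + z) L)"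
      using eventually_happens'[OF p(1)] by blast
    then show ?case
      using L(1) by (intro exI[of _ "z # map (\<lambda>a. a + z) L"]) simp
  qed simp
  then obtain L where "length L = n" "\<forall>a\<in>set L. shift_stable p G a"
    "sorted_wrt (\<lambda>b a. shift_stable p (E (a - b)) b) L" by blast
  then show ?thesis
    by (intro exI[of _ L]) (auto simp: shift_stable_def G_def elim: sorted_wrt_mono_rel[rotated])
qed

lemma almost_orthogonal_sum:
  fixes u :: "'m \<Rightarrow> 'a::complex_hilbert_space" and C \<epsilon> :: real
  assumes "\<And>a. norm (u a) \<le> C" and "\<epsilon> \<ge> 0"
    and "sorted_wrt (\<lambda>b a. cmod (cinner (u a) (u b)) \<le> \<epsilon>) L"
  shows "(norm (\<Sum>a\<leftarrow>L. u a))\<^sup>2 \<le> length L * C\<^sup>2 + (length L)\<^sup>2 * \<epsilon>"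
  using assms(3)
proof (induction L)
  case (Cons b L)
  let ?S = "\<Sum>a\<leftarrow>L. u a"
  have "Re (cinner (\<Sum>a\<leftarrow>L. u a) (u b)) \<le> length L * \<epsilon>"
    if "\<forall>a\<in>set L. cmod (cinner (u a) (u b)) \<le> \<epsilon>" for L
    using that
  proof (induction L)
    case (Cons a L)
    have "Re (cinner (u a) (u b)) \<le> \<epsilon>"
      using Cons.prems complex_Re_le_cmod[of "cinner (u a) (u b)"] by force
    with Cons show ?case by (simp add: cinner_add_left algebra_simps)
  qed simp
  then have "Re (cinner (u b) ?S) \<le> length L * \<epsilon>"
    using Cons.prems by (simp add: Re_cinner_commute[of "u b"])
  moreover have "(norm (u b))\<^sup>2 \<le> C\<^sup>2"
    using assms(1) by (intro power_mono) auto
  ultimately have "(norm (u b + ?S))\<^sup>2 \<le> C\<^sup>2 + (length L * C\<^sup>2 + (length L)\<^sup>2 * \<epsilon>) + 2 * (length L * \<epsilon>)"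
    using Cons by (simp add: norm_add_squared)
  also have "\<dots> \<le> length (b # L) * C\<^sup>2 + (length (b # L))\<^sup>2 * \<epsilon>"
    using \<open>\<epsilon> \<ge> 0\<close> by (simp add: power2_eq_square algebra_simps)
  finally show ?case by simp
qed simp

text \<open>If \<open>v\<close> were nonzero, \<open>n\<close> almost orthogonal vectors \<open>u a\<close>, each with inner product about
  \<open>\<parallel>v\<parallel>\<^sup>2\<close> with \<open>v\<close>, would have a sum too short for its inner product with \<open>v\<close>, which is about
  \<open>n \<parallel>v\<parallel>\<^sup>2\<close>.\<close>

lemma van_der_Corput:
  fixes u :: "'m::ab_group_add \<Rightarrow> 'a::complex_hilbert_space"
  assumes p: "p \<noteq> bot" "filter_plus p p = p"
    and bound: "\<And>z. norm (u z) \<le> C"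
    and decorrelated: "\<And>\<epsilon>. \<epsilon> > 0 \<Longrightarrow> \<forall>\<^sub>F w in p. \<forall>\<^sub>F z in p. cmod (cinner (u (z + w)) (u z)) \<le> \<epsilon>"
    and lim: "((\<lambda>z. cinner (u z) v) \<longlongrightarrow> cinner v v) p"
  shows "v = 0"
proof (rule ccontr)
  assume "v \<noteq> 0"
  define V where "V = (norm v)\<^sup>2"
  have V: "V > 0" using \<open>v \<noteq> 0\<close> by (simp add: V_def)
  \<comment> \<open>The slack \<open>V / 8\<close> in both estimates leaves \<open>(7 / 8)\<^sup>2 - 1 / 8 = 41 / 64\<close>.\<close>
  have main: "real n * (41 / 64 * V) \<le> C\<^sup>2" for n
  proof (cases "n = 0")
    case False
    have "((\<lambda>z. Re (cinner (u z) v)) \<longlongrightarrow> V) p"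
      using tendsto_Re[OF lim] by (simp add: V_def norm_squared_eq_cinner)
    then have "\<forall>\<^sub>F z in p. 7 / 8 * V < Re (cinner (u z) v)"
      using V by (intro order_tendstoD(1)) auto
    moreover have "\<forall>\<^sub>F w in p. \<forall>\<^sub>F z in p. cmod (cinner (u (z + w)) (u z)) \<le> V / 8"
      using V by (intro decorrelated) simp
    ultimately obtain L where L: "length L = n" "\<forall>a\<in>set L. 7 / 8 * V < Re (cinner (u a) v)"
      "sorted_wrt (\<lambda>b a. cmod (cinner (u (b + (a - b))) (u b)) \<le> V / 8) L"
      using tail_sums_exist[OF p, of "\<lambda>z. 7 / 8 * V < Re (cinner (u z) v)"
        "\<lambda>w z. cmod (cinner (u (z + w)) (u z)) \<le> V / 8" n] by blast
    define S where "S = (\<Sum>a\<leftarrow>L. u a)"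
    have S_upper: "(norm S)\<^sup>2 \<le> n * C\<^sup>2 + n\<^sup>2 * (V / 8)"
      using almost_orthogonal_sum[where u = u and \<epsilon> = "V / 8" and L = L, OF bound] V L(1,3) by (simp add: S_def)
    have "length L * (7 / 8 * V) \<le> Re (cinner (\<Sum>a\<leftarrow>L. u a) v)"
      using L(2) by (induction L) (auto simp: cinner_add_left algebra_simps)
    then have "n * (7 / 8 * V) \<le> norm S * norm v"
      using Re_cinner_le[of S v] L(1) by (simp add: S_def)
    then have "(n * (7 / 8 * V))\<^sup>2 \<le> (norm S * norm v)\<^sup>2"
      using V by (intro power_mono) auto
    also have "\<dots> \<le> (n * C\<^sup>2 + n\<^sup>2 * (V / 8)) * V"
      using S_upper V by (simp add: power_mult_distrib V_def mult_right_mono)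
    finally have "(n * V) * (n * (49 / 64 * V)) \<le> (n * V) * (C\<^sup>2 + n * (V / 8))"
      by (simp add: power2_eq_square algebra_simps)
    then have "n * (49 / 64 * V) \<le> C\<^sup>2 + n * (V / 8)"
      using False V by (simp add: mult_le_cancel_left_pos)
    then show ?thesis by (simp add: algebra_simps)
  qed simp
  obtain n where "C\<^sup>2 < real n * (41 / 64 * V)"
    using reals_Archimedean3[of "41 / 64 * V"] V by auto
  with main[of n] show False by simp
qed

section \<open>The degree of a polynomial map\<close>

text \<open>Degree in terms of iterated differences: it applies to maps between abelian groups and
  decreases when a difference is taken.\<close>

primrec poly_degree_le :: "nat \<Rightarrow> ('m::ab_group_add \<Rightarrow> 'v::ab_group_add) \<Rightarrow> bool" where
  "poly_degree_le 0 f \<longleftrightarrow> (\<forall>z. f z = f 0)"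
| "poly_degree_le (Suc d) f \<longleftrightarrow> (\<forall>w. poly_degree_le d (\<lambda>z. f (z + w) - f z))"

lemma poly_degree_le_0D: "poly_degree_le 0 f \<Longrightarrow> f y = f z"
  by (metis poly_degree_le.simps(1))

lemma poly_degree_le_SucI:
  "(\<And>w. poly_degree_le d (\<lambda>z. f (z + w) - f z)) \<Longrightarrow> poly_degree_le (Suc d) f"
  by simp

lemma poly_degree_le_SucD: "poly_degree_le (Suc d) f \<Longrightarrow> poly_degree_le d (\<lambda>z. f (z + w) - f z)"
  by simp

lemma poly_degree_le_Suc: "poly_degree_le d f \<Longrightarrow> poly_degree_le (Suc d) f"
proof (induction d arbitrary: f)
  case 0
  have "f (z + w) - f z = 0" for z w
    using poly_degree_le_0D[OF 0, of "z + w" z] by simp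
  then show ?case by simp
next
  case (Suc d)
  show ?case
    by (rule poly_degree_le_SucI, rule Suc.IH, rule poly_degree_le_SucD, rule Suc.prems)
qed

lemma poly_degree_le_mono:
  assumes "poly_degree_le d f" "d \<le> e"
  shows "poly_degree_le e f"
  using assms(2)
proof (induction rule: dec_induct)
  case base
  show ?case by (rule assms(1))
next
  case (step e)
  then show ?case by (intro poly_degree_le_Suc)
qed

lemma poly_degree_le_const: "poly_degree_le d (\<lambda>z. c)"
  by (rule poly_degree_le_mono[of 0]) simp_all

lemma poly_degree_le_add:
  "poly_degree_le d f \<Longrightarrow> poly_degree_le d g \<Longrightarrow> poly_degree_le d (\<lambda>z. f z + g z)"
proof (induction d arbitrary: f g)
  case 0
  have "f z + g z = f 0 + g 0" for z
    using poly_degree_le_0D[OF 0(1), of z 0] poly_degree_le_0D[OF 0(2), of z 0] by (rule arg_cong2)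
  then show ?case
    unfolding poly_degree_le.simps by blast
next
  case (Suc d)
  show ?case
  proof (rule poly_degree_le_SucI)
    fix w
    have "poly_degree_le d (\<lambda>z. (f (z + w) - f z) + (g (z + w) - g z))"
      by (intro Suc.IH) (rule poly_degree_le_SucD[OF Suc.prems(1)], rule poly_degree_le_SucD[OF Suc.prems(2)])
    then show "poly_degree_le d (\<lambda>z. f (z + w) + g (z + w) - (f z + g z))"
      by (simp only: add_diff_add)
  qed
qed

lemma poly_degree_le_scale:
  fixes f :: "'m::ab_group_add \<Rightarrow> 'r::comm_ring_1"
  shows "poly_degree_le d f \<Longrightarrow> poly_degree_le d (\<lambda>z. c * f z)"
proof (induction d arbitrary: f)
  case 0
  have "c * f z = c * f 0" for z
    using poly_degree_le_0D[OF 0, of z 0] by (rule arg_cong)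
  then show ?case
    unfolding poly_degree_le.simps by blast
next
  case (Suc d)
  show ?case
  proof (rule poly_degree_le_SucI)
    fix w
    have "poly_degree_le d (\<lambda>z. c * (f (z + w) - f z))"
      by (rule Suc.IH, rule poly_degree_le_SucD[OF Suc.prems])
    then show "poly_degree_le d (\<lambda>z. c * f (z + w) - c * f z)"
      by (simp only: right_diff_distrib)
  qed
qed

lemma poly_degree_le_mult:
  fixes f g :: "'m::ab_group_add \<Rightarrow> 'r::comm_ring_1"
  assumes "poly_degree_le a f" "poly_degree_le b g"
  shows "poly_degree_le (a + b) (\<lambda>z. f z * g z)"
  using assms
proof (induction "a + b" arbitrary: a b f g rule: less_induct)
  case less
  show ?case
  proof (cases "a = 0 \<or> b = 0")
    case True
    then show ?thesis
    proof
      assume a: "a = 0"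
      have "poly_degree_le b (\<lambda>z. f 0 * g z)"
        by (rule poly_degree_le_scale[OF less.prems(2)])
      moreover have "f 0 * g z = f z * g z" for z
        using poly_degree_le_0D[of f 0 z] less.prems(1) a by metis
      ultimately show ?thesis by (simp only: a add_0)
    next
      assume b: "b = 0"
      have "poly_degree_le a (\<lambda>z. g 0 * f z)"
        by (rule poly_degree_le_scale[OF less.prems(1)])
      moreover have "g 0 * f z = f z * g z" for z
        using poly_degree_le_0D[of g 0 z] less.prems(2) b by (metis mult.commute)
      ultimately show ?thesis by (simp only: b add_0_right)
    qed
  next
    case False
    then obtain a' b' where ab: "a = Suc a'" "b = Suc b'"
      by (metis not0_implies_Suc)
    have "poly_degree_le (a' + b) (\<lambda>z. f (z + w) * g (z + w) - f z * g z)" for w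
    proof -
      define df dg where "df z = f (z + w) - f z" and "dg z = g (z + w) - g z" for z
      have d: "poly_degree_le a' df" "poly_degree_le b' dg"
        using less.prems unfolding ab df_def dg_def by (blast intro: poly_degree_le_SucD)+
      have "poly_degree_le (a' + b) (\<lambda>z. df z * g z)"
        using d less.prems by (intro less.hyps) (auto simp: ab simp del: poly_degree_le.simps)
      moreover have "poly_degree_le (a + b') (\<lambda>z. f z * dg z)"
        using d less.prems by (intro less.hyps) (auto simp: ab simp del: poly_degree_le.simps)
      then have "poly_degree_le (a' + b) (\<lambda>z. f z * dg z)"
        by (simp add: ab)
      moreover have "poly_degree_le (a' + b') (\<lambda>z. df z * dg z)"
        using d by (intro less.hyps) (auto simp: ab simp del: poly_degree_le.simps)
      then have "poly_degree_le (a' + b) (\<lambda>z. df z * dg z)"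
        by (rule poly_degree_le_mono) (simp add: ab)
      ultimately have "poly_degree_le (a' + b) (\<lambda>z. df z * g z + f z * dg z + df z * dg z)"
        by (intro poly_degree_le_add)
      moreover have "df z * g z + f z * dg z + df z * dg z = f (z + w) * g (z + w) - f z * g z" for z
        by (simp add: df_def dg_def algebra_simps)
      ultimately show ?thesis by (simp only:)
    qed
    then show ?thesis
      unfolding ab(1) add_Suc by (rule poly_degree_le_SucI)
  qed
qed

lemma poly_degree_le_diff_const: "poly_degree_le d f \<Longrightarrow> poly_degree_le d (\<lambda>z. f z - c)"
  by (induction d arbitrary: f c) simp_all

section \<open>Polynomial limits along one idempotent ultrafilter\<close>

context unitary_representation
begin

text \<open>Induction on the degree.  The map \<open>D w z = \<phi> (z + w) - \<phi> z - \<phi> w\<close> has smaller degree in \<open>z\<close> and vanishes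
  at \<open>z = 0\<close>, so \<open>Q w = p-lim\<^sub>z W (D w z)\<close> is a projection.  By the chain condition so is the
  weak limit \<open>Q'\<close> of \<open>Q w\<close>, and hence \<open>Q w\<close> converges to \<open>Q'\<close> even strongly.

  On the kernel of \<open>Q'\<close> the correlations \<open>\<langle>W (\<phi> (z + w)) x, W (\<phi> z) x\<rangle>\<close> tend to
  \<open>\<langle>W (\<phi> w) (Q w x), x\<rangle>\<close>, which is small, and the van der Corput lemma gives \<open>P x = 0\<close>.  On the range of
  \<open>Q'\<close> the operator \<open>W (D w z)\<close> is almost the identity, so \<open>\<phi>\<close> behaves like a homomorphism and
  \<open>P (P x) = P x\<close> follows from the idempotence of \<open>p\<close>.\<close>

lemma polynomial_limit_projection:
  fixes p :: "'m::ab_group_add filter" and \<phi> :: "'m \<Rightarrow> 'v"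
  assumes p: "ultrafilter p" "filter_plus p p = p"
    and F: "noetherian_family F" "\<And>\<psi> w. \<psi> \<in> F \<Longrightarrow> (\<lambda>z. \<psi> (z + w) - \<psi> z - \<psi> w) \<in> F"
    and "poly_degree_le d \<phi>" "\<phi> \<in> F" "\<phi> 0 = 0" "weak_limit p (\<lambda>z. W (\<phi> z)) P"
  shows "idem_contraction P"
  using assms(5-)
proof (induction d arbitrary: \<phi> P)
  case 0
  note p_bot = ultrafilter_neq_bot[OF p(1)]
  have "\<phi> z = 0" for z
    using 0(1,3) by simp
  then have "weak_limit p (\<lambda>z. W (\<phi> z)) id"
    by (simp add: weak_limit_def W_zero)
  then have "P = id"
    by (rule weak_limit_unique[OF p_bot "0.prems"(4)])
  then show ?case
    using ccontraction_id by (simp add: idem_contraction_def id_def)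
next
  case (Suc d)
  note p_bot = ultrafilter_neq_bot[OF p(1)]
  note \<phi> = Suc.prems(1-3) and lim = Suc.prems(4)
  define D where "D w z = \<phi> (z + w) - \<phi> z - \<phi> w" for w z
  have \<phi>_diff: "\<phi> (z + w) - \<phi> z = \<phi> w + D w z" for w z
    by (simp add: D_def)
  have Pc: "ccontraction P"
    by (rule weak_limit_ccontraction[OF p(1) _ lim]) (rule W_contraction)
  have "\<exists>Q. ccontraction Q \<and> weak_limit p (\<lambda>z. W (D w z)) Q" for w
    by (rule weak_limit_exists[OF p(1)]) (rule W_contraction)
  then obtain Q where Q: "\<And>w. ccontraction (Q w)" "\<And>w. weak_limit p (\<lambda>z. W (D w z)) (Q w)"
    by metis
  obtain Q' where Q': "weak_limit p Q Q'"
    using weak_limit_exists[OF p(1), of Q] Q(1) by blast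
  have D: "D w \<in> F" for w
    using F(2)[OF \<phi>(2), of w] by (simp add: D_def[abs_def])
  have Q_proj: "idem_contraction (Q w)" for w
  proof (rule Suc.IH[OF _ D _ Q(2)])
    show "poly_degree_le d (D w)"
      using \<phi>(1) poly_degree_le_diff_const[of d "\<lambda>z. \<phi> (z + w) - \<phi> z" "\<phi> w"]
      by (simp add: D_def[abs_def])
    show "D w 0 = 0"
      by (simp add: D_def \<phi>(3))
  qed
  have Q'_proj: "idem_contraction Q'"
    by (rule limit_of_noetherian_family_projection[OF p(1) p(1) Q(2) Q_proj F(1) D Q'])
  have Q'_strong: "((\<lambda>w. Q w x) \<longlongrightarrow> Q' x) p" for x
    by (rule strong_limit_projections[OF Q_proj Q' Q'_proj])
  have Q'_idem: "Q' (Q' x) = Q' x" and Q'c: "ccontraction Q'" for x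
    using Q'_proj by (auto simp: idem_contraction_def)
  have on_kernel: "P x = 0" if x: "Q' x = 0" for x
  proof (rule van_der_Corput[OF p_bot p(2), of "\<lambda>z. W (\<phi> z) x"])
    show "norm (W (\<phi> z) x) \<le> norm x" for z
      by (simp add: W_norm)
    show "((\<lambda>z. cinner (W (\<phi> z) x) (P x)) \<longlongrightarrow> cinner (P x) (P x)) p"
      by (rule weak_limitD[OF lim])
    fix \<epsilon> :: real assume "\<epsilon> > 0"
    have corr: "((\<lambda>z. cmod (cinner (W (\<phi> (z + w)) x) (W (\<phi> z) x))) \<longlongrightarrow> cmod (cinner (W (\<phi> w) (Q w x)) x)) p" for w
    proof -
      have "cinner (W (\<phi> (z + w)) x) (W (\<phi> z) x) = cinner (W (\<phi> w) (W (D w z) x)) x" for z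
        by (simp add: W_cinner \<phi>_diff W_add)
      then show ?thesis
        using tendsto_norm[OF weak_limit_apply[OF W_contraction Q(2)]] by simp
    qed
    have "((\<lambda>w. norm (Q w x) * norm x) \<longlongrightarrow> norm (Q' x) * norm x) p"
      by (intro tendsto_intros Q'_strong)
    then have "\<forall>\<^sub>F w in p. norm (Q w x) * norm x < \<epsilon>"
      using \<open>\<epsilon> > 0\<close> x by (intro order_tendstoD(2)) auto
    then show "\<forall>\<^sub>F w in p. \<forall>\<^sub>F z in p. cmod (cinner (W (\<phi> (z + w)) x) (W (\<phi> z) x)) \<le> \<epsilon>"
    proof eventually_elim
      case (elim w)
      have "cmod (cinner (W (\<phi> w) (Q w x)) x) < \<epsilon>"
        using cinner_Cauchy_Schwarz[of "W (\<phi> w) (Q w x)" x] elim by (simp add: W_norm)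
      from order_tendstoD(2)[OF corr this] show ?case
        by eventually_elim simp
    qed
  qed
  have on_range: "P (P x) = P x" if x: "Q' x = x" for x
  proof (rule eq_if_cinner_eq)
    fix y
    have "\<exists>l. ((\<lambda>z. cinner (W (\<phi> (w + z)) x) y) \<longlongrightarrow> l) p" for w
    proof (rule ultrafilter_bounded_limit[OF p(1)])
      show "cmod (cinner (W (\<phi> (w + z)) x) y) \<le> norm x * norm y" for z
        using cinner_Cauchy_Schwarz[of "W (\<phi> (w + z)) x" y] by (simp add: W_norm)
    qed
    then obtain g where g: "\<And>w. ((\<lambda>z. cinner (W (\<phi> (w + z)) x) y) \<longlongrightarrow> g w) p"
      by metis
    have g_lim: "(g \<longlongrightarrow> cinner (P x) y) p"
      by (rule limit_of_limits[OF eventually_idempotent[OF p(2)] p_bot weak_limitD[OF lim] g])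
    \<comment> \<open>\<open>g w\<close> and \<open>\<langle>W (\<phi> w) (P x), y\<rangle>\<close> are the inner limits of the coefficients of \<open>W (\<phi> (w + z))\<close> and of \<open>W (\<phi> w + \<phi> z)\<close>.\<close>
    define \<delta> where "\<delta> w = sqrt (2 * (norm x)\<^sup>2 - 2 * Re (cinner (Q w x) x)) * norm y" for w
    have "(\<delta> \<longlongrightarrow> sqrt (2 * (norm x)\<^sup>2 - 2 * Re (cinner (Q' x) x)) * norm y) p"
      unfolding \<delta>_def by (intro tendsto_intros weak_limitD[OF Q'])
    then have \<delta>_lim: "(\<delta> \<longlongrightarrow> 0) p"
      by (simp add: x norm_squared_eq_cinner)
    have close: "cmod (g w - cinner (W (\<phi> w) (P x)) y) \<le> \<delta> w" for w
    proof (rule tendsto_le[OF p_bot])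
      show "((\<lambda>z. cmod (cinner (W (\<phi> (w + z)) x) y - cinner (W (\<phi> w) (W (\<phi> z) x)) y))
          \<longlongrightarrow> cmod (g w - cinner (W (\<phi> w) (P x)) y)) p"
        by (intro tendsto_norm tendsto_diff g weak_limit_apply[OF W_contraction lim])
      have "((\<lambda>z. sqrt ((norm (W (D w z) x - x))\<^sup>2) * norm y) \<longlongrightarrow> \<delta> w) p"
        unfolding \<delta>_def by (intro tendsto_intros displacement_limit Q(2))
      then show "((\<lambda>z. norm (W (D w z) x - x) * norm y) \<longlongrightarrow> \<delta> w) p"
        by simp
      have "cmod (cinner (W (\<phi> (w + z)) x) y - cinner (W (\<phi> w) (W (\<phi> z) x)) y)
          \<le> norm (W (D w z) x - x) * norm y" for z
      proof -
        have "cinner (W (\<phi> (w + z)) x) y - cinner (W (\<phi> w) (W (\<phi> z) x)) y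
            = cinner (W (\<phi> (w + z)) x - W (\<phi> w + \<phi> z) x) y"
          by (simp add: cinner_diff_left W_add)
        also have "cmod \<dots> \<le> norm (W (\<phi> (w + z)) x - W (\<phi> w + \<phi> z) x) * norm y"
          by (rule cinner_Cauchy_Schwarz)
        also have "norm (W (\<phi> (w + z)) x - W (\<phi> w + \<phi> z) x) = norm (W (D w z) x - x)"
        proof -
          have "\<phi> (w + z) - (\<phi> w + \<phi> z) = D w z"
            by (metis D_def add.commute diff_diff_eq)
          then show ?thesis
            using W_distance[of "\<phi> (w + z)" x "\<phi> w + \<phi> z" x] by simp
        qed
        finally show ?thesis .
      qed
      then show "\<forall>\<^sub>F z in p. cmod (cinner (W (\<phi> (w + z)) x) y - cinner (W (\<phi> w) (W (\<phi> z) x)) y)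
          \<le> norm (W (D w z) x - x) * norm y"
        by simp
    qed
    have "((\<lambda>w. g w - cinner (W (\<phi> w) (P x)) y) \<longlongrightarrow> 0) p"
      by (rule Lim_null_comparison[OF _ \<delta>_lim]) (simp add: close)
    moreover have "((\<lambda>w. g w - cinner (W (\<phi> w) (P x)) y) \<longlongrightarrow> cinner (P x) y - cinner (P (P x)) y) p"
      by (intro tendsto_diff g_lim weak_limitD[OF lim])
    ultimately show "cinner (P (P x)) y = cinner (P x) y"
      using tendsto_unique[OF p_bot] by fastforce
  qed
  have "P (P x) = P x" for x
  proof -
    have "P (x - Q' x) = 0"
      by (rule on_kernel) (simp add: ccontractionD[OF Q'c] Q'_idem)
    then have "P x = P (Q' x)"
      by (simp add: ccontractionD[OF Pc])
    then show ?thesis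
      using on_range[OF Q'_idem] by simp
  qed
  with Pc show ?case by (simp add: idem_contraction_def)
qed

end

section \<open>Iterated limits as limits along one ultrafilter\<close>

text \<open>The tensor product of the ultrafilters in the list, as a filter on the lists of the same length.\<close>

primrec iterated_filter :: "'z filter list \<Rightarrow> 'z list filter" where
  "iterated_filter [] = principal {[]}"
| "iterated_filter (p # ps) =
    Abs_filter (\<lambda>A. \<forall>\<^sub>F z in p. \<forall>\<^sub>F zs in iterated_filter ps. A (z # zs))"

lemma eventually_iterated_filter_Cons:
  "eventually A (iterated_filter (p # ps)) \<longleftrightarrow>
    (\<forall>\<^sub>F z in p. \<forall>\<^sub>F zs in iterated_filter ps. A (z # zs))"
  unfolding iterated_filter.simps
proof (rule eventually_Abs_filter, rule is_filter.intro)
  fix A B :: "'a list \<Rightarrow> bool"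
  assume "\<forall>x. A x \<longrightarrow> B x" and "\<forall>\<^sub>F z in p. \<forall>\<^sub>F zs in iterated_filter ps. A (z # zs)"
  then show "\<forall>\<^sub>F z in p. \<forall>\<^sub>F zs in iterated_filter ps. B (z # zs)"
    by (blast intro: eventually_mono)
qed (simp_all add: eventually_conj_iff)

lemma ultrafilter_iterated_filter:
  "(\<And>p. p \<in> set ps \<Longrightarrow> ultrafilter p) \<Longrightarrow> ultrafilter (iterated_filter ps)"
proof (induction ps)
  case Nil
  then show ?case
    by (auto simp: ultrafilter_def eventually_principal principal_eq_bot_iff)
next
  case (Cons p ps)
  then have p: "ultrafilter p" and ps: "ultrafilter (iterated_filter ps)" by auto
  have not_bot: "\<not> eventually (\<lambda>_. False) (iterated_filter (p # ps))"
    using ultrafilter_neq_bot[OF p] ultrafilter_neq_bot[OF ps]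
    by (simp only: eventually_iterated_filter_Cons eventually_const trivial_limit_def) auto
  have "eventually A (iterated_filter (p # ps)) \<or> eventually (\<lambda>zs. \<not> A zs) (iterated_filter (p # ps))" for A
  proof -
    have "(\<forall>\<^sub>F z in p. \<forall>\<^sub>F zs in iterated_filter ps. A (z # zs)) \<or>
        (\<forall>\<^sub>F z in p. \<not> (\<forall>\<^sub>F zs in iterated_filter ps. A (z # zs)))"
      by (rule ultrafilter_cases[OF p])
    moreover have "\<forall>\<^sub>F z in p. \<forall>\<^sub>F zs in iterated_filter ps. \<not> A (z # zs)"
      if "\<forall>\<^sub>F z in p. \<not> (\<forall>\<^sub>F zs in iterated_filter ps. A (z # zs))"
      using that by (rule eventually_mono) (rule ultrafilter_not[OF ps])
    ultimately show ?thesis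
      unfolding eventually_iterated_filter_Cons by blast
  qed
  with not_bot show ?case
    unfolding ultrafilter_def trivial_limit_def by blast
qed

lemma tendsto_iterated_filter_Cons:
  fixes F :: "'z list \<Rightarrow> 'b::metric_space"
  assumes inner: "\<And>z. ((\<lambda>zs. F (z # zs)) \<longlongrightarrow> g z) (iterated_filter ps)" and outer: "(g \<longlongrightarrow> l) p"
  shows "(F \<longlongrightarrow> l) (iterated_filter (p # ps))"
proof (rule tendstoI)
  fix e :: real assume "e > 0"
  have "\<forall>\<^sub>F z in p. dist (g z) l < e / 2"
    using \<open>e > 0\<close> by (intro tendstoD[OF outer]) simp
  then show "\<forall>\<^sub>F zs in iterated_filter (p # ps). dist (F zs) l < e"
    unfolding eventually_iterated_filter_Cons
  proof eventually_elim
    case (elim z)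
    have "\<forall>\<^sub>F zs in iterated_filter ps. dist (F (z # zs)) (g z) < e / 2"
      using \<open>e > 0\<close> by (intro tendstoD[OF inner]) simp
    then show ?case
      by eventually_elim (use elim in \<open>auto intro: dist_triangle_half_r[of "g z"] simp: dist_commute\<close>)
  qed
qed

lemma has_iterated_limit_imp_tendsto:
  fixes F :: "'z list \<Rightarrow> 'b::metric_space"
  shows "has_iterated_limit ps F l \<Longrightarrow> (F \<longlongrightarrow> l) (iterated_filter ps)"
proof (induction ps arbitrary: F l)
  case Nil
  then show ?case
    by (auto simp: tendsto_def eventually_principal)
next
  case (Cons p ps)
  then show ?case
    by (auto intro!: tendsto_iterated_filter_Cons simp del: iterated_filter.simps)
qed

lemma has_iterated_limit_exists:
  fixes F :: "'z list \<Rightarrow> complex"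
  assumes "\<And>p. p \<in> set ps \<Longrightarrow> ultrafilter p" and "\<And>zs. cmod (F zs) \<le> K"
  shows "\<exists>l. has_iterated_limit ps F l"
  using assms
proof (induction ps arbitrary: F)
  case (Cons p ps)
  have "\<exists>l. has_iterated_limit ps (\<lambda>zs. F (z # zs)) l" for z
    using Cons by auto
  then obtain g where g: "\<And>z. has_iterated_limit ps (\<lambda>zs. F (z # zs)) (g z)"
    by metis
  have "cmod (g z) \<le> K" for z
  proof (rule tendsto_upperbound[OF tendsto_norm])
    show "((\<lambda>zs. F (z # zs)) \<longlongrightarrow> g z) (iterated_filter ps)"
      by (rule has_iterated_limit_imp_tendsto[OF g])
    show "iterated_filter ps \<noteq> bot"
      using Cons.prems(1) by (intro ultrafilter_neq_bot ultrafilter_iterated_filter) auto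
  qed (simp add: Cons.prems(2))
  then obtain l where "(g \<longlongrightarrow> l) p"
    using ultrafilter_bounded_limit[of p g K] Cons.prems(1) by auto
  with g show ?case by auto
qed auto

lemma has_iterated_limit_iff_tendsto:
  fixes F :: "'z list \<Rightarrow> complex"
  assumes ps: "\<And>p. p \<in> set ps \<Longrightarrow> ultrafilter p" and bound: "\<And>zs. cmod (F zs) \<le> K"
  shows "has_iterated_limit ps F l \<longleftrightarrow> (F \<longlongrightarrow> l) (iterated_filter ps)"
proof
  assume lim: "(F \<longlongrightarrow> l) (iterated_filter ps)"
  obtain l' where l': "has_iterated_limit ps F l'"
    using has_iterated_limit_exists[of ps F K] assms by blast
  have "l = l'"
    using ps by (intro tendsto_unique[OF _ lim has_iterated_limit_imp_tendsto[OF l']]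
        ultrafilter_neq_bot ultrafilter_iterated_filter)
  with l' show "has_iterated_limit ps F l" by simp
qed (rule has_iterated_limit_imp_tendsto)

section \<open>Polynomials generate Noetherian families\<close>

text \<open>Rational polynomials in all coordinates of the vectors in the list, generated as a ring, so that
  their properties follow by induction from those of constants and coordinates.\<close>

inductive polynomial_map :: "((nat \<Rightarrow>\<^sub>0 int) list \<Rightarrow> rat) \<Rightarrow> bool" where
  polynomial_map_const: "polynomial_map (\<lambda>zs. c)"
| polynomial_map_coordinate: "polynomial_map (\<lambda>zs. of_int (Poly_Mapping.lookup (zs ! j) k))"
| polynomial_map_add: "polynomial_map f \<Longrightarrow> polynomial_map g \<Longrightarrow> polynomial_map (\<lambda>zs. f zs + g zs)"
| polynomial_map_mult: "polynomial_map f \<Longrightarrow> polynomial_map g \<Longrightarrow> polynomial_map (\<lambda>zs. f zs * g zs)"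

lemma polynomial_map_sum:
  "(\<And>i. i \<in> I \<Longrightarrow> polynomial_map (f i)) \<Longrightarrow> polynomial_map (\<lambda>zs. \<Sum>i\<in>I. f i zs)"
  by (induction I rule: infinite_finite_induct) (auto intro: polynomial_map.intros)

lemma polynomial_map_prod:
  "(\<And>i. i \<in> I \<Longrightarrow> polynomial_map (f i)) \<Longrightarrow> polynomial_map (\<lambda>zs. \<Prod>i\<in>I. f i zs)"
  by (induction I rule: infinite_finite_induct) (auto intro: polynomial_map.intros)

lemma polynomial_map_power: "polynomial_map f \<Longrightarrow> polynomial_map (\<lambda>zs. f zs ^ n)"
  by (induction n) (auto intro: polynomial_map.intros)

lemma polynomial_map_poly_eval:
  "polynomial_map (\<lambda>zs. poly_eval f (\<lambda>(j, k). of_int (Poly_Mapping.lookup (zs ! j) k)))"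
  unfolding poly_eval_def case_prod_beta
  by (intro polynomial_map_sum polynomial_map_mult polynomial_map_prod polynomial_map_power
      polynomial_map_const polynomial_map_coordinate)

lemma polynomial_map_Cons: "polynomial_map f \<Longrightarrow> polynomial_map (\<lambda>ys. f (z # ys))"
proof (induction rule: polynomial_map.induct)
  case (polynomial_map_coordinate j k)
  show ?case
    by (cases j) (simp_all add: polynomial_map.intros)
next
  case (polynomial_map_add f g)
  from polynomial_map_add.IH show ?case by (rule polynomial_map.polynomial_map_add)
next
  case (polynomial_map_mult f g)
  from polynomial_map_mult.IH show ?case by (rule polynomial_map.polynomial_map_mult)
qed (rule polynomial_map.polynomial_map_const)

lemma polynomial_map_degree:
  "polynomial_map f \<Longrightarrow> \<exists>d. poly_degree_le d (\<lambda>z. f (z # c))"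
proof (induction rule: polynomial_map.induct)
  case (polynomial_map_coordinate j k)
  show ?case
  proof (cases j)
    case 0
    have "poly_degree_le (Suc 0) (\<lambda>z. rat_of_int (Poly_Mapping.lookup z k))"
      by (simp add: lookup_add)
    then show ?thesis using 0 by (intro exI[of _ "Suc 0"]) simp
  next
    case (Suc i)
    then show ?thesis by simp (blast intro: poly_degree_le_const)
  qed
next
  case (polynomial_map_add f g)
  then obtain a b where "poly_degree_le a (\<lambda>z. f (z # c))" "poly_degree_le b (\<lambda>z. g (z # c))" by blast
  then have "poly_degree_le (max a b) (\<lambda>z. f (z # c))" "poly_degree_le (max a b) (\<lambda>z. g (z # c))"
    by (auto intro: poly_degree_le_mono)
  then show ?case
    using poly_degree_le_add[of "max a b" "\<lambda>z. f (z # c)" "\<lambda>z. g (z # c)"] by blast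
next
  case (polynomial_map_mult f g)
  then obtain a b where "poly_degree_le a (\<lambda>z. f (z # c))" "poly_degree_le b (\<lambda>z. g (z # c))" by blast
  then show ?case
    using poly_degree_le_mult[of a "\<lambda>z. f (z # c)" b "\<lambda>z. g (z # c)"] by blast
qed (blast intro: poly_degree_le_const)

lemma of_int_fun_apply: "of_int k = (\<lambda>_::'y. of_int k :: 'r::comm_ring_1)"
proof (induction k rule: int_induct[where k = 0])
  case base
  then show ?case by (simp add: zero_fun_def)
next
  case (step1 i)
  then show ?case by (simp add: plus_fun_def one_fun_def)
next
  case (step2 i)
  then show ?case by (simp add: fun_diff_def one_fun_def)
qed

text \<open>The argument \<open>a w y\<close> is split into the parameter \<open>w\<close> and the variable \<open>y\<close>; the claim is that the
  functions of \<open>y\<close> obtained for all \<open>w\<close> lie in one finitely generated group.\<close>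

lemma fg_family_polynomial_map:
  fixes a :: "'w \<Rightarrow> 'y \<Rightarrow> (nat \<Rightarrow>\<^sub>0 int) list"
  assumes "\<And>j k. fg_family (\<lambda>w y. rat_of_int (Poly_Mapping.lookup (a w y ! j) k))"
  shows "polynomial_map f \<Longrightarrow> fg_family (\<lambda>w y. f (a w y))"
proof (induction rule: polynomial_map.induct)
  case (polynomial_map_const c)
  show ?case by (rule fg_family_const)
next
  case (polynomial_map_coordinate j k)
  show ?case by (rule assms)
next
  case (polynomial_map_add f g)
  from fg_family_add[OF polynomial_map_add.IH] show ?case by (simp add: plus_fun_def)
next
  case (polynomial_map_mult f g)
  from fg_family_mult[OF polynomial_map_mult.IH] show ?case by (simp add: times_fun_def)
qed

text \<open>An integer parameter contributes only integer multiples of the constant function 1.  This is where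
  it matters that the variables range over integer vectors.\<close>

lemma fg_family_parameter: "fg_family (\<lambda>w (y::'y). rat_of_int (k w))"
proof -
  have "fg_family (\<lambda>w. of_int (k w) :: 'y \<Rightarrow> rat)"
    by (rule fg_family_of_int)
  then show ?thesis
    by (simp add: of_int_fun_apply)
qed

lemma fg_family_Cons:
  assumes "polynomial_map f"
  shows "fg_family (\<lambda>z ys. f (z # ys))"
proof (rule fg_family_polynomial_map[OF _ assms])
  show "fg_family (\<lambda>z ys. rat_of_int (Poly_Mapping.lookup ((z # ys) ! j) k))" for j k
    by (cases j) (simp_all add: fg_family_parameter fg_family_const)
qed

lemma fg_family_translate:
  assumes "polynomial_map f"
  shows "fg_family (\<lambda>w z. f ((z + w) # c))"
proof (rule fg_family_polynomial_map[OF _ assms])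
  show "fg_family (\<lambda>w z. rat_of_int (Poly_Mapping.lookup (((z + w) # c) ! j) k))" for j k
  proof (cases j)
    case 0
    then show ?thesis
      using fg_family_add[OF fg_family_const fg_family_parameter,
          of "\<lambda>z. rat_of_int (Poly_Mapping.lookup z k)" "\<lambda>w. Poly_Mapping.lookup w k"]
      by (simp add: lookup_add plus_fun_def)
  qed (simp add: fg_family_const)
qed

lemma int_span_hom:
  assumes h: "\<And>x y. h (x - y) = h x - h y" and "x \<in> int_span B"
  shows "h x \<in> int_span (h ` B)"
  using assms(2)
proof induction
  case int_span_zero
  then show ?case using h[of 0 0] by (simp add: int_span.int_span_zero)
qed (auto simp: h intro: int_span.intros)

lemma fg_family_hom:
  assumes "fg_family F" and "\<And>x y. h (x - y) = h x - h y"
  shows "fg_family (\<lambda>w. h (F w))"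
  using assms int_span_hom[of h] unfolding fg_family_def
  by (metis (no_types, lifting) finite_imageI image_subset_iff)

abbreviation rat_vector_map :: "('y \<Rightarrow> nat \<Rightarrow> int) \<Rightarrow> 'y \<Rightarrow> nat \<Rightarrow> rat"
  where "rat_vector_map \<psi> \<equiv> \<lambda>y i. rat_of_int (\<psi> y i)"

lemma fg_family_vector:
  assumes comp: "\<And>i. i < m \<Longrightarrow> fg_family (\<lambda>w y. rat_of_int (\<Phi> w y i))"
    and zero: "\<And>w y i. i \<ge> m \<Longrightarrow> \<Phi> w y i = 0"
  shows "fg_family (\<lambda>w. rat_vector_map (\<Phi> w))"
proof -
  define e where "e i g = (\<lambda>(y::'b) i'. if i' = i then g y else (0::rat))" for i :: nat and g
  have "fg_family (\<lambda>w. e i (\<lambda>y. rat_of_int (\<Phi> w y i)))" if "i < m" for i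
    using comp[OF that] by (rule fg_family_hom) (simp add: e_def fun_eq_iff)
  then have "fg_family (\<lambda>w. \<Sum>i<m. e i (\<lambda>y. rat_of_int (\<Phi> w y i)))"
    by (intro fg_family_sum) simp
  moreover have "(\<Sum>i<m. e i (\<lambda>y. rat_of_int (\<Phi> w y i))) = rat_vector_map (\<Phi> w)" for w
  proof (intro ext)
    fix y i'
    have "(\<Sum>i<n. e i (\<lambda>y. rat_of_int (\<Phi> w y i))) y i' = (\<Sum>i<n. e i (\<lambda>y. rat_of_int (\<Phi> w y i)) y i')" for n
      by (induction n) simp_all
    then show "(\<Sum>i<m. e i (\<lambda>y. rat_of_int (\<Phi> w y i))) y i' = rat_of_int (\<Phi> w y i')"
      using zero[of i' w y] by (auto simp: e_def)
  qed
  ultimately show ?thesis by simp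
qed

lemma noetherian_family_fg:
  assumes "finite B" "\<And>\<psi>. \<psi> \<in> F \<Longrightarrow> rat_vector_map \<psi> \<in> int_span B"
  shows "noetherian_family F"
proof (rule noetherian_family_if_embeds[OF _ _ assms])
  show "inj rat_vector_map"
    by (rule injI) (simp add: fun_eq_iff)
qed (simp_all add: fun_eq_iff)

definition polynomial_vector_map :: "nat \<Rightarrow> ((nat \<Rightarrow>\<^sub>0 int) list \<Rightarrow> nat \<Rightarrow> int) \<Rightarrow> bool"
  where "polynomial_vector_map m \<phi> \<longleftrightarrow>
    (\<forall>i. polynomial_map (\<lambda>zs. of_int (\<phi> zs i))) \<and> (\<forall>zs. \<forall>i\<ge>m. \<phi> zs i = 0)"

lemma polynomial_vector_map_degree:
  assumes "polynomial_vector_map m \<phi>"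
  shows "\<exists>d. poly_degree_le d (\<lambda>z. \<phi> (z # c))"
proof -
  have "\<exists>d. poly_degree_le d (\<lambda>z. rat_of_int (\<phi> (z # c) i))" for i
    using assms polynomial_map_degree[of "\<lambda>zs. rat_of_int (\<phi> zs i)" c]
    by (simp add: polynomial_vector_map_def)
  then obtain d where d: "\<And>i. poly_degree_le (d i) (\<lambda>z. rat_of_int (\<phi> (z # c) i))"
    by metis
  define D where "D = (\<Sum>i<m. d i)"
  have "poly_degree_le D (\<lambda>z. rat_of_int (\<phi> (z # c) i))" for i
  proof (cases "i < m")
    case True
    then have "d i \<le> D" by (simp add: D_def member_le_sum)
    with d show ?thesis by (rule poly_degree_le_mono)
  next
    case False
    then have "\<phi> (z # c) i = 0" for z
      using assms by (simp add: polynomial_vector_map_def)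
    then show ?thesis by (simp add: poly_degree_le_const)
  qed
  moreover have vector: "poly_degree_le D \<psi>" if "\<And>i. poly_degree_le D (\<lambda>z. rat_of_int (\<psi> z i))"
    for \<psi> :: "(nat \<Rightarrow>\<^sub>0 int) \<Rightarrow> nat \<Rightarrow> int"
    using that
  proof (induction D arbitrary: \<psi>)
    case 0
    then show ?case by (simp add: fun_eq_iff)
  next
    case (Suc D)
    have "poly_degree_le D (\<lambda>z. \<psi> (z + w) - \<psi> z)" for w
      using Suc.prems by (intro Suc.IH) simp
    then show ?case by simp
  qed
  ultimately have "poly_degree_le D (\<lambda>z. \<phi> (z # c))"
    by (intro vector)
  then show ?thesis by blast
qed

text \<open>\<open>F\<close> consists of the maps all of whose translates lie in one finitely generated group that contains the
  translates of \<open>\<phi>\<close> and the integer constants; the latter are included on account of the term \<open>\<psi> w\<close>.\<close>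

lemma difference_closed_noetherian_family:
  assumes \<phi>: "polynomial_vector_map m \<phi>"
  obtains F where "noetherian_family F" "(\<lambda>z. \<phi> (z # c)) \<in> F"
    "\<And>\<psi> w. \<psi> \<in> F \<Longrightarrow> (\<lambda>z. \<psi> (z + w) - \<psi> z - \<psi> w) \<in> F"
proof -
  have "fg_family (\<lambda>w. rat_vector_map (\<lambda>z. \<phi> ((z + w) # c)))"
    using \<phi> by (intro fg_family_vector[of m] fg_family_translate[of "\<lambda>zs. rat_of_int (\<phi> zs i)" for i])
      (auto simp: polynomial_vector_map_def)
  then obtain B where B: "finite B" "\<And>w. rat_vector_map (\<lambda>z. \<phi> ((z + w) # c)) \<in> int_span B"
    unfolding fg_family_def by blast
  have "fg_family (\<lambda>v. rat_vector_map (\<lambda>_::nat \<Rightarrow>\<^sub>0 int. (\<lambda>i. if i < m then v i else 0)))"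
    by (rule fg_family_vector[of m]) (simp_all add: fg_family_parameter)
  then obtain C where C: "finite C"
    "\<And>v. rat_vector_map (\<lambda>_::nat \<Rightarrow>\<^sub>0 int. (\<lambda>i. if i < m then v i else 0)) \<in> int_span C"
    unfolding fg_family_def by blast
  have C': "rat_vector_map (\<lambda>_::nat \<Rightarrow>\<^sub>0 int. v) \<in> int_span C" if "\<And>i. i \<ge> m \<Longrightarrow> v i = 0" for v
  proof -
    have "(\<lambda>i. if i < m then v i else 0) = v" using that by auto
    then have eq: "rat_vector_map (\<lambda>_::nat \<Rightarrow>\<^sub>0 int. (\<lambda>i. if i < m then v i else 0)) = rat_vector_map (\<lambda>_. v)"
      by metis
    show ?thesis using C(2)[of v] unfolding eq .
  qed
  define F where "F = {\<psi>. (\<forall>w. rat_vector_map (\<lambda>z. \<psi> (z + w)) \<in> int_span (B \<union> C)) \<and> (\<forall>z. \<forall>i\<ge>m. \<psi> z i = 0)}"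
  show thesis
  proof (rule that[of F])
    show "noetherian_family F"
    proof (rule noetherian_family_fg[of "B \<union> C"])
      show "rat_vector_map \<psi> \<in> int_span (B \<union> C)" if "\<psi> \<in> F" for \<psi>
        using that unfolding F_def by (auto dest: spec[of _ 0])
    qed (simp add: B C)
    show "(\<lambda>z. \<phi> (z # c)) \<in> F"
      using \<phi> B(2) int_span_mono[of B "B \<union> C"] by (auto simp: F_def polynomial_vector_map_def)
    fix \<psi> w assume \<psi>: "\<psi> \<in> F"
    have "rat_vector_map (\<lambda>z. \<psi> (z + v + w) - \<psi> (z + v) - \<psi> w) \<in> int_span (B \<union> C)" for v
    proof -
      have "rat_vector_map (\<lambda>z. \<psi> (z + (v + w))) - rat_vector_map (\<lambda>z. \<psi> (z + v))
          - rat_vector_map (\<lambda>z. \<psi> w) \<in> int_span (B \<union> C)"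
        using \<psi> C'[of "\<psi> w"] int_span_mono[of C "B \<union> C"] by (intro int_span_diff) (auto simp: F_def)
      moreover have "rat_vector_map (\<lambda>z. \<psi> (z + (v + w))) - rat_vector_map (\<lambda>z. \<psi> (z + v))
          - rat_vector_map (\<lambda>z. \<psi> w) = rat_vector_map (\<lambda>z. \<psi> (z + v + w) - \<psi> (z + v) - \<psi> w)"
        by (simp add: fun_eq_iff add.assoc)
      ultimately show ?thesis by simp
    qed
    then show "(\<lambda>z. \<psi> (z + w) - \<psi> z - \<psi> w) \<in> F"
      using \<psi> by (auto simp: F_def)
  qed
qed

section \<open>Iterated polynomial limits\<close>

text \<open>Induction on the number of ultrafilters.  The part \<open>g z = \<phi> (z, 0)\<close> of \<open>\<phi>\<close> depends on the
  outermost variable \<open>z\<close> only and gives a projection \<open>A\<close>.  For fixed \<open>z\<close>, the remainder \<open>\<Phi> z\<close> vanishes at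
  \<open>0\<close>, so its limit \<open>R z\<close> is a projection by induction hypothesis, and the weak limit \<open>T\<close> of \<open>R z\<close> is a projection
  by the chain condition.  Since \<open>R z\<close> converges strongly, the whole limit is the product of the commuting
  projections \<open>A\<close> and \<open>T\<close>.\<close>

lemma iterated_polynomial_limit_projection:
  fixes W :: "(nat \<Rightarrow> int) \<Rightarrow> 'a::complex_hilbert_space \<Rightarrow> 'a"
  assumes "unitary_representation W"
    and "\<And>p. p \<in> set ps \<Longrightarrow> ultrafilter p \<and> filter_plus p p = p"
    and "polynomial_vector_map m \<phi>" "\<phi> (replicate (length ps) 0) = 0"
    and "weak_limit (iterated_filter ps) (\<lambda>zs. W (\<phi> zs)) P"
  shows "idem_contraction P"
  using assms(2-)
proof (induction ps arbitrary: \<phi> P)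
  case Nil
  interpret unitary_representation W by fact
  have "W (\<phi> []) x = x" for x
    using Nil.prems(3) W_zero[of x] by (simp only: list.size(3) replicate_0)
  then have "weak_limit (principal {[]}) (\<lambda>zs. W (\<phi> zs)) id"
    unfolding weak_limit_def by (intro allI tendsto_eventually) (simp add: eventually_principal)
  then have "P = id"
    using Nil.prems(4) by (intro weak_limit_unique[of "principal {[]}"]) (simp_all add: principal_eq_bot_iff)
  then show ?case
    using ccontraction_id by (simp add: idem_contraction_def id_def)
next
  case (Cons p ps)
  interpret unitary_representation W by fact
  note \<phi> = Cons.prems(2)
  let ?\<pi> = "iterated_filter ps"
  define origin where "origin = replicate (length ps) (0 :: nat \<Rightarrow>\<^sub>0 int)"
  define g where "g z = \<phi> (z # origin)" for z
  define \<Phi> where "\<Phi> z ys = \<phi> (z # ys) - g z" for z ys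
  have p: "ultrafilter p" "filter_plus p p = p" and \<pi>: "ultrafilter ?\<pi>"
    using Cons.prems(1) by (auto intro: ultrafilter_iterated_filter)
  note p_bot = ultrafilter_neq_bot[OF p(1)] and \<pi>_bot = ultrafilter_neq_bot[OF \<pi>]
  obtain A where A: "weak_limit p (\<lambda>z. W (g z)) A"
    using weak_limit_exists[OF p(1), of "\<lambda>z. W (g z)"] W_contraction by blast
  have "\<exists>R. \<forall>z. ccontraction (R z) \<and> weak_limit ?\<pi> (\<lambda>ys. W (\<Phi> z ys)) (R z)"
    by (intro choice allI weak_limit_exists[OF \<pi>] W_contraction)
  then obtain R where R: "\<And>z. ccontraction (R z)" "\<And>z. weak_limit ?\<pi> (\<lambda>ys. W (\<Phi> z ys)) (R z)"
    by blast
  obtain T where T: "weak_limit p R T"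
    using weak_limit_exists[OF p(1), of R] R(1) by blast
  have A_proj: "idem_contraction A"
  proof -
    obtain F where F: "noetherian_family F" "g \<in> F"
      "\<And>\<psi> w. \<psi> \<in> F \<Longrightarrow> (\<lambda>z. \<psi> (z + w) - \<psi> z - \<psi> w) \<in> F"
      using difference_closed_noetherian_family[OF \<phi>, of origin] unfolding g_def[abs_def] by blast
    obtain d where "poly_degree_le d g"
      using polynomial_vector_map_degree[OF \<phi>, of origin] unfolding g_def[abs_def] by blast
    moreover have "g 0 = 0"
      using Cons.prems(3) by (simp add: g_def origin_def zero_fun_def)
    ultimately show ?thesis
      using polynomial_limit_projection[OF p F(1,3) _ F(2) _ A] by blast
  qed
  have R_proj: "idem_contraction (R z)" for z
  proof (rule Cons.IH[OF _ _ _ R(2)])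
    show "ultrafilter p' \<and> filter_plus p' p' = p'" if "p' \<in> set ps" for p'
      using Cons.prems(1) that by simp
    have "polynomial_map (\<lambda>ys. rat_of_int (\<phi> (z # ys) i) + rat_of_int (- g z i))" for i
      using \<phi> polynomial_map_Cons[of "\<lambda>zs. rat_of_int (\<phi> zs i)" z]
      by (intro polynomial_map_add polynomial_map_const) (simp add: polynomial_vector_map_def)
    then show "polynomial_vector_map m (\<Phi> z)"
      using \<phi> by (simp add: polynomial_vector_map_def \<Phi>_def g_def)
    show "\<Phi> z (replicate (length ps) 0) = 0"
      by (simp add: \<Phi>_def g_def origin_def zero_fun_def)
  qed
  have "fg_family (\<lambda>z. rat_vector_map (\<Phi> z))"
  proof (rule fg_family_vector[of m])
    show "fg_family (\<lambda>z ys. rat_of_int (\<Phi> z ys i))" for i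
      using \<phi> fg_family_add[OF fg_family_Cons[of "\<lambda>zs. rat_of_int (\<phi> zs i)"] fg_family_parameter[of "\<lambda>z. - g z i"]]
      by (simp add: polynomial_vector_map_def \<Phi>_def plus_fun_def)
    show "\<Phi> z ys i = 0" if "i \<ge> m" for z ys i
      using \<phi> that by (simp add: polynomial_vector_map_def \<Phi>_def g_def)
  qed
  then have noeth: "noetherian_family (range \<Phi>)"
    unfolding fg_family_def using noetherian_family_fg[of _ "range \<Phi>"] by blast
  have T_proj: "idem_contraction T"
    by (rule limit_of_noetherian_family_projection[OF p(1) \<pi> R(2) R_proj noeth _ T]) simp
  have "weak_limit p (\<lambda>z. W (g z) \<circ> R z) (A \<circ> T)"
    by (rule weak_limit_comp_strong[OF _ A strong_limit_projections[OF R_proj T T_proj]])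
      (rule W_contraction)
  then have outer: "((\<lambda>z. cinner (W (g z) (R z x)) y) \<longlongrightarrow> cinner (A (T x)) y) p" for x y
    unfolding weak_limit_def by simp
  have inner: "((\<lambda>ys. cinner (W (\<phi> (z # ys)) x) y) \<longlongrightarrow> cinner (W (g z) (R z x)) y) ?\<pi>" for z x y
  proof -
    have "W (\<phi> (z # ys)) x = W (g z) (W (\<Phi> z ys) x)" for ys
      using W_add[of "g z" "\<Phi> z ys" x] by (simp add: \<Phi>_def)
    then show ?thesis
      using weak_limit_apply[OF W_contraction R(2)] by simp
  qed
  have "weak_limit (iterated_filter (p # ps)) (\<lambda>zs. W (\<phi> zs)) (A \<circ> T)"
    unfolding weak_limit_def comp_def
    by (intro allI tendsto_iterated_filter_Cons[OF inner outer])
  then have P: "P = A \<circ> T"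
    using Cons.prems(1,4)
    by (intro weak_limit_unique[OF ultrafilter_neq_bot[OF ultrafilter_iterated_filter[of "p # ps"]]]) auto
  have A: "ccontraction A" "\<And>x. A (A x) = A x" and Tc: "ccontraction T" "\<And>x. T (T x) = T x"
    using A_proj T_proj by (auto simp: idem_contraction_def)
  have "T (A x) = A (T x)" for x
  proof (rule weak_limit_commute[OF p_bot A(1) T])
    show "R z (A x) = A (R z x)" for z x
      by (rule weak_limits_commute[OF \<pi>_bot R(2) p(1) \<open>weak_limit p (\<lambda>z. W (g z)) A\<close>])
  qed
  then show ?case
    unfolding P idem_contraction_def using ccontraction_comp[OF A(1) Tc(1)] by (simp add: A Tc)
qed

section \<open>Powers of commuting unitary operators\<close>

lemma int_power_Suc:
  assumes "bij U"
  shows "int_power U (k + 1) x = U (int_power U k x)"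
proof (cases "k \<ge> 0")
  case True
  then show ?thesis by (simp add: int_power_def nat_add_distrib)
next
  case False
  then obtain n where k: "k = - int (Suc n)"
    by (metis int_cases2 not_le of_nat_0_le_iff negD)
  have "U (inv U y) = y" for y
    using assms by (simp add: bij_is_surj surj_f_inv_f)
  moreover have "int_power U k = inv U ^^ Suc n"
    unfolding int_power_def k by (simp del: of_nat_Suc funpow.simps)
  moreover have "int_power U (k + 1) = inv U ^^ n"
    by (cases "n = 0") (simp_all add: int_power_def k)
  ultimately show ?thesis by simp
qed

lemma int_power_add:
  assumes U: "bij U"
  shows "int_power U (a + b) x = int_power U a (int_power U b x)"
proof (induction a rule: int_induct[where k = 0])
  case base
  then show ?case by (simp add: int_power_def)
next
  case (step1 i)
  then show ?case
    using int_power_Suc[OF U, of "i + b" x] int_power_Suc[OF U, of i] by (simp add: add.commute add.left_commute)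
next
  case (step2 i)
  have "U (int_power U (i - 1 + b) x) = U (int_power U (i - 1) (int_power U b x))"
    using step2 int_power_Suc[OF U, of "i - 1 + b" x] int_power_Suc[OF U, of "i - 1"] by simp
  then show ?case
    using bij_is_inj[OF U] by (simp add: inj_eq)
qed

lemma int_power_commute:
  assumes U: "bij U" and comm: "\<And>x. V (U x) = U (V x)"
  shows "V (int_power U k x) = int_power U k (V x)"
proof (induction k rule: int_induct[where k = 0])
  case base
  then show ?case by (simp add: int_power_def)
next
  case (step1 i)
  then show ?case by (simp add: int_power_Suc[OF U] comm)
next
  case (step2 i)
  have "U (V (int_power U (i - 1) x)) = U (int_power U (i - 1) (V x))"
    using step2 int_power_Suc[OF U, of "i - 1"] by (simp flip: comm)
  then show ?case
    using bij_is_inj[OF U] by (simp add: inj_eq)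
qed

lemma unitary_ccontraction:
  assumes "unitary U"
  shows "bij U" "ccontraction U" "ccontraction (inv U)"
proof -
  have lin: "bounded_linear U" "\<And>c x. U (c *\<^sub>C x) = c *\<^sub>C U x" and surj: "surj U"
    and iso: "\<And>x y. cinner (U x) (U y) = cinner x y"
    using assms by (auto simp: unitary_def bounded_clinear_def)
  have norm: "norm (U x) = norm x" for x
    using iso[of x x] by (metis norm_squared_eq_cinner norm_ge_zero power2_eq_iff_nonneg)
  have add: "U (x + y) = U x + U y" and diff: "U (x - y) = U x - U y" for x y
    using lin(1) by (simp_all add: bounded_linear.linear linear_add linear_diff)
  have "inj U"
  proof (rule injI)
    fix x y assume "U x = U y"
    then have "norm (x - y) = 0"
      using norm[of "x - y"] by (simp add: diff)
    then show "x = y" by simp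
  qed
  with surj show bij: "bij U" by (simp add: bij_def)
  show "ccontraction U"
    by (simp add: ccontraction_def add lin(2) norm)
  have inv: "U (inv U x) = x" "inv U (U x) = x" for x
    using surj \<open>inj U\<close> by (simp_all add: surj_f_inv_f)
  show "ccontraction (inv U)"
    unfolding ccontraction_def
  proof (intro conjI allI)
    show "inv U (x + y) = inv U x + inv U y" for x y
      using inv(2)[of "inv U x + inv U y"] by (simp add: add inv(1))
    show "inv U (c *\<^sub>C x) = c *\<^sub>C inv U x" for c x
      using inv(2)[of "c *\<^sub>C inv U x"] by (simp add: lin(2) inv(1))
    show "norm (inv U x) \<le> norm x" for x
      using norm[of "inv U x"] by (simp add: inv(1))
  qed
qed

lemma ccontraction_funpow: "ccontraction T \<Longrightarrow> ccontraction (T ^^ n)"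
  by (induction n) (simp_all add: ccontraction_id ccontraction_comp)

lemma ccontraction_int_power: "unitary U \<Longrightarrow> ccontraction (int_power U k)"
  by (simp add: int_power_def ccontraction_funpow unitary_ccontraction)

definition power_product :: "(nat \<Rightarrow> 'a \<Rightarrow> 'a) \<Rightarrow> nat \<Rightarrow> (nat \<Rightarrow> int) \<Rightarrow> 'a \<Rightarrow> 'a"
  where "power_product U m v = foldr (\<circ>) (map (\<lambda>i. int_power (U i) (v i)) [0..<m]) id"

lemma unitary_representation_power_product:
  assumes U: "\<And>i. i < m \<Longrightarrow> unitary (U i)"
    and comm: "\<And>i j. i < m \<Longrightarrow> j < m \<Longrightarrow> U i \<circ> U j = U j \<circ> U i"
  shows "unitary_representation (power_product U m)"
proof
  define prodl where "prodl v js = foldr (\<circ>) (map (\<lambda>i. int_power (U i) (v i)) js) id" for v js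
  have simps: "prodl v [] x = x" "prodl v (i # js) x = int_power (U i) (v i) (prodl v js x)" for v i js x
    by (simp_all add: prodl_def)
  have comm': "int_power (U i) a (int_power (U j) b x) = int_power (U j) b (int_power (U i) a x)"
    if "i < m" "j < m" for i j a b x
  proof (rule int_power_commute[OF unitary_ccontraction(1)[OF U[OF that(2)]]])
    have "U j (U i x) = U i (U j x)" for x
      using comm[OF that] by (metis comp_apply)
    then show "int_power (U i) a (U j x) = U j (int_power (U i) a x)" for x
      by (rule int_power_commute[OF unitary_ccontraction(1)[OF U[OF that(1)]], symmetric])
  qed
  have contr: "ccontraction (prodl v js)" if "set js \<subseteq> {..<m}" for v js
    using that
  proof (induction js)
    case Nil
    then show ?case using ccontraction_id by (simp add: prodl_def id_def)
  next
    case (Cons i js)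
    then have "ccontraction (int_power (U i) (v i) \<circ> prodl v js)"
      by (intro ccontraction_comp ccontraction_int_power U) auto
    then show ?case by (simp add: prodl_def comp_def)
  qed
  have past: "int_power (U i) a (prodl v js x) = prodl v js (int_power (U i) a x)"
    if "i < m" "set js \<subseteq> {..<m}" for i a v js x
    using that(2) by (induction js arbitrary: x) (simp_all add: simps comm'[OF that(1)])
  have add: "prodl (u + v) js x = prodl u js (prodl v js x)" if "set js \<subseteq> {..<m}" for u v js x
    using that
  proof (induction js arbitrary: x)
    case (Cons i js)
    then have i: "i < m" and js: "set js \<subseteq> {..<m}" by auto
    have "prodl (u + v) (i # js) x = int_power (U i) (u i) (int_power (U i) (v i) (prodl u js (prodl v js x)))"
      unfolding simps Cons.IH[OF js] plus_fun_apply
      by (rule int_power_add[OF unitary_ccontraction(1)[OF U[OF i]]])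
    also have "\<dots> = prodl u (i # js) (prodl v (i # js) x)"
      by (simp only: simps past[OF i js, of "v i" u])
    finally show ?case .
  qed (simp add: simps)
  have zero: "prodl 0 js x = x" for js x
    by (induction js) (simp_all add: simps int_power_def)
  have eq: "power_product U m v = prodl v [0..<m]" for v
    by (simp add: power_product_def prodl_def)
  show "ccontraction (power_product U m v)" for v
    unfolding eq by (rule contr) auto
  show "power_product U m (u + v) x = power_product U m u (power_product U m v x)" for u v x
    unfolding eq by (rule add) auto
  show "power_product U m 0 x = x" for x
    unfolding eq by (rule zero)
qed

text \<open>The exponents as a map into the sequences of integers, on which \<open>power_product\<close> is a
  representation; entries from \<open>m\<close> on are set to 0 so that finitely many coordinates determine the map.\<close>

definition exponent_map :: "nat \<Rightarrow> (nat \<Rightarrow> rat_mpoly) \<Rightarrow> (nat \<Rightarrow>\<^sub>0 int) list \<Rightarrow> nat \<Rightarrow> int"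
  where "exponent_map m f zs i = (if i < m then int_poly_eval (f i) zs else 0)"

lemma poly_op_product_eq: "poly_op_product U m f zs = power_product U m (exponent_map m f zs)"
  unfolding poly_op_product_def power_product_def
  by (rule arg_cong[of _ _ "\<lambda>xs. foldr (\<circ>) xs id"]) (simp add: exponent_map_def)

lemma of_int_int_poly_eval:
  assumes "f \<in> int_valued_polys s n"
  shows "rat_of_int (int_poly_eval f zs)
    = poly_eval f (\<lambda>(j, k). of_int (Poly_Mapping.lookup (zs ! j) k))"
proof -
  have "poly_eval f (\<lambda>v. of_int (case v of (j, k) \<Rightarrow> Poly_Mapping.lookup (zs ! j) k)) \<in> \<int>"
    using assms unfolding int_valued_polys_def by blast
  then have "poly_eval f (\<lambda>(j, k). of_int (Poly_Mapping.lookup (zs ! j) k)) \<in> \<int>"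
    by (simp add: case_prod_unfold)
  then obtain r where "poly_eval f (\<lambda>(j, k). of_int (Poly_Mapping.lookup (zs ! j) k)) = of_int r"
    by (rule Ints_cases)
  then show ?thesis
    by (simp add: int_poly_eval_def)
qed

lemma polynomial_vector_map_exponent_map:
  assumes "limit_data m s n p f"
  shows "polynomial_vector_map m (exponent_map m f)"
proof -
  have "polynomial_map (\<lambda>zs. rat_of_int (exponent_map m f zs i))" for i
  proof (cases "i < m")
    case True
    then have "f i \<in> int_valued_polys s n"
      using assms by (simp add: limit_data_def)
    then show ?thesis
      using True polynomial_map_poly_eval[of "f i"] by (simp add: exponent_map_def of_int_int_poly_eval)
  next
    case False
    then show ?thesis by (simp add: exponent_map_def polynomial_map_const)
  qed
  then show ?thesis
    by (simp add: polynomial_vector_map_def exponent_map_def)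
qed

text \<open>The replicated list has only \<open>s\<close> entries, so the evaluation at the constant 0 is reached
  because no variable with a larger index occurs in \<open>f i\<close>.\<close>

lemma exponent_map_origin:
  assumes "limit_data m s n p f"
  shows "exponent_map m f (replicate s 0) = 0"
proof
  fix i
  show "exponent_map m f (replicate s 0) i = 0 i"
  proof (cases "i < m")
    case True
    then have f: "poly_vars (f i) \<subseteq> {(j, k). j < s \<and> k < n j}" "poly_eval (f i) (\<lambda>_. 0) = 0"
      using assms by (auto simp: limit_data_def int_valued_polys_def)
    have "poly_eval (f i) (\<lambda>(j, k). of_int (Poly_Mapping.lookup (replicate s 0 ! j) k)) = poly_eval (f i) (\<lambda>_. 0)"
      unfolding poly_eval_def
    proof (intro sum.cong refl arg_cong2[of _ _ _ _ "(*)"] prod.cong)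
      fix mon v assume "mon \<in> Poly_Mapping.keys (f i)" "v \<in> Poly_Mapping.keys mon"
      then have "fst v < s" using f(1) unfolding poly_vars_def by fastforce
      then show "(case v of (j, k) \<Rightarrow> rat_of_int (Poly_Mapping.lookup (replicate s 0 ! j) k)) ^ Poly_Mapping.lookup mon v
          = 0 ^ Poly_Mapping.lookup mon v"
        by (simp add: case_prod_beta)
    qed
    then show ?thesis
      using f(2) True by (simp add: exponent_map_def int_poly_eval_def)
  qed (simp add: exponent_map_def)
qed

theorem theorem5p1:
  fixes U :: "nat \<Rightarrow> 'a::complex_hilbert_space \<Rightarrow> 'a" and m :: nat
  assumes "m \<ge> 1"
    and "\<And>i. i < m \<Longrightarrow> unitary (U i)"
    and "\<And>i j. i < m \<Longrightarrow> j < m \<Longrightarrow> U i \<circ> U j = U j \<circ> U i"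
  shows "(\<forall>s n p f. limit_data m s n p f \<longrightarrow>
            (\<exists>!P. is_iterated_weak_limit U m s p f P) \<and>
            (\<forall>P. is_iterated_weak_limit U m s p f P \<longrightarrow> orthogonal_projection P)) \<and>
         (\<forall>s n p f P s' n' p' f' P'.
            limit_data m s n p f \<and> is_iterated_weak_limit U m s p f P \<and>
            limit_data m s' n' p' f' \<and> is_iterated_weak_limit U m s' p' f' P' \<longrightarrow>
            P \<circ> P' = P' \<circ> P)"
proof -
  interpret unitary_representation "power_product U m"
    by (rule unitary_representation_power_product) (rule assms(2-3); assumption)+
  let ?W = "\<lambda>f zs. power_product U m (exponent_map m f zs)"
  let ?ps = "\<lambda>s p. map p [0..<s]"
  have ps: "ultrafilter q \<and> filter_plus q q = q"
    if "limit_data m s n p f" "q \<in> set (map p [0..<s])" for s n p f q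
    using that by (auto simp: limit_data_def idempotent_ultrafilter_def)
  have \<pi>: "ultrafilter (iterated_filter (map p [0..<s]))" if "limit_data m s n p f" for s n p f
    using ps[OF that] by (intro ultrafilter_iterated_filter) blast
  have limit_iff: "is_iterated_weak_limit U m s p f P \<longleftrightarrow>
      bounded_clinear P \<and> weak_limit (iterated_filter (map p [0..<s])) (?W f) P"
    if "limit_data m s n p f" for s n p f P
  proof -
    have "has_iterated_limit (map p [0..<s]) (\<lambda>zs. cinner (?W f zs x) y) (cinner (P x) y) \<longleftrightarrow>
        ((\<lambda>zs. cinner (?W f zs x) y) \<longlongrightarrow> cinner (P x) y) (iterated_filter (map p [0..<s]))" for x y
    proof (rule has_iterated_limit_iff_tendsto)
      show "cmod (cinner (?W f zs x) y) \<le> norm x * norm y" for zs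
        using cinner_Cauchy_Schwarz[of "?W f zs x" y] by (simp add: W_norm)
    qed (use ps[OF that] in blast)
    then show ?thesis
      by (simp add: is_iterated_weak_limit_def weak_limit_def poly_op_product_eq)
  qed
  have ex1: "\<exists>!P. is_iterated_weak_limit U m s p f P" if data: "limit_data m s n p f" for s n p f
  proof -
    obtain P where "ccontraction P" "weak_limit (iterated_filter (map p [0..<s])) (?W f) P"
      using weak_limit_exists[OF \<pi>[OF data], of "?W f"] W_contraction by blast
    then show ?thesis
      unfolding limit_iff[OF data]
      using weak_limit_unique[OF ultrafilter_neq_bot[OF \<pi>[OF data]]] ccontraction_imp_bounded_clinear
      by blast
  qed
  have projection: "orthogonal_projection P"
    if data: "limit_data m s n p f" and "is_iterated_weak_limit U m s p f P" for s n p f P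
  proof (intro idem_contraction_imp_orthogonal_projection
      iterated_polynomial_limit_projection[OF unitary_representation_axioms])
    show "weak_limit (iterated_filter (map p [0..<s])) (?W f) P"
      using that limit_iff by blast
    show "polynomial_vector_map m (exponent_map m f)"
      by (rule polynomial_vector_map_exponent_map[OF data])
    show "exponent_map m f (replicate (length (map p [0..<s])) 0) = 0"
      using exponent_map_origin[OF data] by simp
  qed (rule ps[OF data])
  have commute: "P \<circ> P' = P' \<circ> P"
    if data: "limit_data m s n p f" "is_iterated_weak_limit U m s p f P"
      and data': "limit_data m s' n' p' f'" "is_iterated_weak_limit U m s' p' f' P'"
    for s n p f P s' n' p' f' P'
  proof
    fix x
    have "weak_limit (iterated_filter (map p [0..<s])) (?W f) P"
      "weak_limit (iterated_filter (map p' [0..<s'])) (?W f') P'"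
      using that limit_iff by blast+
    then have "P (P' x) = P' (P x)"
      by (rule weak_limits_commute[OF ultrafilter_neq_bot[OF \<pi>[OF data(1)]] _ \<pi>[OF data'(1)]])
    then show "(P \<circ> P') x = (P' \<circ> P) x" by simp
  qed
  show ?thesis
    by (intro conjI allI impI; (elim conjE)?; rule ex1 projection commute; assumption)
qed

end
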